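(* Let $n\ge 9$ be an integer. In the statement "$\lambda_h(Q_{n,2})=2^{n-1}$ for every integer $h$ with $\left\lceil\frac{11\times 2^{n-1}}{48}\right\rceil\le h\le 2^{n-1}$", the lower and upper bounds on $h$ are both tight, that is: (1) for $h_0=\left\lceil\frac{11\times 2^{n-1}}{48}\right\rceil$ one has $\lambda_{h_0-1}(Q_{n,2})<2^{n-1}=\lambda_{h_0}(Q_{n,2})$; (2) for $h>2^{n-1}$ the graph $Q_{n,2}$ has no $h$-extra edge-cut (so $\lambda_h(Q_{n,2})$ is not defined).
   Context: The $(n,2)$-enhanced hypercube $Q_{n,2}$ is the graph whose vertices are all binary strings $x_nx_{n-1}\cdots x_1$ with $x_i\in\{0,1\}$. Two vertices $x=x_n\cdots x_1$ and $y$ are adjacent iff either $y$ differs from $x$ in exactly one position, or $y=x_n\bar x_{n-1}\bar x_{n-2}\cdots\bar x_1$, where $\bar x_i=1-x_i$. (It is $(n+1)$-regular with $2^n$ vertices.) For a connected graph $G$ and a positive integer $h$, an $h$-extra edge-cut is a set of edges of $G$ whose deletion yields a disconnected graph all of whose components have at least $h$ vertices. The $h$-extra edge-connectivity $\lambda_h(G)$ is the minimum cardinality of an $h$-extra edge-cut of $G$. *)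

theory Defs
  imports Complex_Main "HOL-Library.Extended_Nat"
begin

text \<open>A simple graph is a pair of a vertex set and a set of two-element sets of vertices.\<close>

type_synonym 'a ugraph = "'a set \<times> 'a set set"

abbreviation vertices :: "'a ugraph \<Rightarrow> 'a set" where
  "vertices G \<equiv> fst G"

abbreviation edges :: "'a ugraph \<Rightarrow> 'a set set" where
  "edges G \<equiv> snd G"

definition delete_edges :: "'a ugraph \<Rightarrow> 'a set set \<Rightarrow> 'a ugraph" where
  "delete_edges G F = (vertices G, edges G - F)"

definition connectivity_rel :: "'a ugraph \<Rightarrow> ('a \<times> 'a) set" where
  "connectivity_rel G =
     {(u, v). u \<in> vertices G \<and> v \<in> vertices G \<and> (u, v) \<in> {(x, y). {x, y} \<in> edges G}\<^sup>*}"

definition components :: "'a ugraph \<Rightarrow> 'a set set" where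
  "components G = vertices G // connectivity_rel G"

definition connected_graph :: "'a ugraph \<Rightarrow> bool" where
  "connected_graph G \<longleftrightarrow>
     vertices G \<noteq> {} \<and> (\<forall>u \<in> vertices G. \<forall>v \<in> vertices G. (u, v) \<in> connectivity_rel G)"

definition extra_edge_cut :: "nat \<Rightarrow> 'a ugraph \<Rightarrow> 'a set set \<Rightarrow> bool" where
  "extra_edge_cut h G F \<longleftrightarrow>
     F \<subseteq> edges G \<and> \<not> connected_graph (delete_edges G F) \<and>
     (\<forall>C \<in> components (delete_edges G F). h \<le> card C)"

text \<open>
  The infimum is taken in the extended naturals. For a finite graph it is the minimum
  cardinality of an \<open>h\<close>-extra edge-cut if one exists; it is \<open>\<infinity>\<close>
  if there is none, so an undefined connectivity is not below any natural number.
\<close>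

definition extra_edge_connectivity :: "nat \<Rightarrow> 'a ugraph \<Rightarrow> enat" where
  "extra_edge_connectivity h G = (INF F \<in> {F. extra_edge_cut h G F}. enat (card F))"

text \<open>
  The string \<open>x\<^sub>n x\<^sub>n\<^sub>-\<^sub>1 \<dots> x\<^sub>1\<close> is the list in the order written: its head is \<open>x\<^sub>n\<close>.
\<close>

definition binary_strings :: "nat \<Rightarrow> bool list set" where
  "binary_strings n = {x. length x = n}"

definition enhanced_hypercube_adj :: "nat \<Rightarrow> bool list \<Rightarrow> bool list \<Rightarrow> bool" where
  "enhanced_hypercube_adj n x y \<longleftrightarrow>
     card {i. i < n \<and> x ! i \<noteq> y ! i} = 1 \<or> y = hd x # map Not (tl x)"

definition enhanced_hypercube :: "nat \<Rightarrow> bool list ugraph" where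
  "enhanced_hypercube n =
     (binary_strings n,
      {{x, y} | x y. x \<in> binary_strings n \<and> y \<in> binary_strings n \<and>
                     enhanced_hypercube_adj n x y})"

end

theory Submission imports Defs begin

text \<open>
  \<open>Q\<^sub>n\<^sub>,\<^sub>2\<close> consists of two copies of the folded hypercube of dimension \<open>m = n - 1\<close>,
  joined by a perfect matching. The key fact is that a set of at most half of the vertices of the
  folded hypercube spans no more edges than some set of the same size in a hypercube. It follows
  that a set of at most \<open>2 ^ m\<close> vertices of \<open>Q\<^sub>n\<^sub>,\<^sub>2\<close> either has, up to complementation in one
  copy, a boundary of at least \<open>2 ^ m\<close> for trivial reasons, or has a boundary at least as large
  as an optimal set of the same size in the hypercube of dimension \<open>n + 1\<close>. For the latter, only
  sizes \<open>2 ^ (n - 3) - r\<close> below \<open>2 ^ (n - 3)\<close> are delicate: the boundary is at least \<open>2 ^ m\<close> as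
  soon as every set of size \<open>r\<close> in the hypercube of dimension \<open>n - 3\<close> has boundary at least
  \<open>4 * r\<close>, which holds exactly up to
  \<open>r = (1/16 + 1/64 + \<dots>) * 2 ^ (n - 3) = 2 ^ (n - 3) / 12\<close>. A set of the next size violating this
  inequality, removed from a subcube of codimension 3, gives the smaller cut.
\<close>

section \<open>The edge-isoperimetric function of the hypercube\<close>

text \<open>
  This is twice the maximal number of edges of a hypercube inside a set of \<open>n\<close> vertices,
  a maximal set splitting into two halves that are as equal as possible.
\<close>

function cube_degsum :: "nat \<Rightarrow> nat" where
  "cube_degsum n = (if n \<le> 1 then 0 else cube_degsum (n div 2) + cube_degsum (n - n div 2) + 2 * (n div 2))"
  by auto
termination by (relation "measure id") auto

declare cube_degsum.simps [simp del]

lemma cube_degsum_0 [simp]: "cube_degsum 0 = 0" and cube_degsum_1 [simp]: "cube_degsum (Suc 0) = 0"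
  by (simp_all add: cube_degsum.simps)

lemma cube_degsum_even: "cube_degsum (2 * n) = 2 * cube_degsum n + 2 * n"
proof (cases "n = 0")
  case False
  then show ?thesis by (subst cube_degsum.simps) auto
qed simp

lemma cube_degsum_odd: "cube_degsum (2 * n + 1) = cube_degsum n + cube_degsum (n + 1) + 2 * n"
proof (cases "n = 0")
  case False
  have "(2 * n + 1) div 2 = n" "2 * n + 1 - n = n + 1" by auto
  with False show ?thesis by (subst cube_degsum.simps) auto
qed simp

text \<open>Both sizes are halved, and the halves are paired so that their sums are the two halves
  of \<open>a + b\<close>. The inequality expresses that no distribution over two opposite faces of
  a cube beats equal halving.\<close>

lemma cube_degsum_superadd: "cube_degsum a + cube_degsum b + 2 * min a b \<le> cube_degsum (a + b)"
proof (induction "a + b" arbitrary: a b rule: less_induct)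
  case less
  consider "a = 0" | "b = 0" | "a = 1" "b = 1" | "a > 0" "b > 0" "a + b > 2" by linarith
  then show ?case
  proof cases
    case 3
    have "cube_degsum (2 * 1) = 2" by (subst cube_degsum_even) simp
    then show ?thesis using 3 by (simp add: numeral_2_eq_2)
  next
    case 4
    define a' b' where "a' = a div 2" and "b' = b div 2"
    have IH: "cube_degsum c + cube_degsum d + 2 * min c d \<le> cube_degsum (c + d)"
      if "c + d < a + b" for c d
      using less that by blast
    consider "a = 2*a'" "b = 2*b'" | "a = 2*a'" "b = 2*b'+1" | "a = 2*a'+1" "b = 2*b'"
      | "a = 2*a'+1" "b = 2*b'+1" unfolding a'_def b'_def by linarith
    then show ?thesis
    proof cases
      case 1
      have e: "cube_degsum (a + b) = 2 * cube_degsum (a' + b') + 2 * (a' + b')"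
        using cube_degsum_even[of "a' + b'"] 1 by (simp add: algebra_simps)
      show ?thesis
        using IH[of a' b'] 1 4 unfolding e by (simp add: cube_degsum_even min_def split: if_splits)
    next
      case 2
      have e: "cube_degsum (a + b) = cube_degsum (a' + b') + cube_degsum (a' + (b' + 1)) + 2 * (a' + b')"
        using cube_degsum_odd[of "a' + b'"] 2 by (simp add: algebra_simps)
      have f: "cube_degsum a = 2 * cube_degsum a' + 2 * a'" "cube_degsum b = cube_degsum b' + cube_degsum (b' + 1) + 2 * b'"
        unfolding 2(1)[THEN arg_cong[where f=cube_degsum]] 2(2)[THEN arg_cong[where f=cube_degsum]] cube_degsum_even cube_degsum_odd by auto
      have i2: "cube_degsum a' + cube_degsum b' + 2 * min a' b' \<le> cube_degsum (a' + b')"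
        "cube_degsum a' + cube_degsum (b' + 1) + 2 * min a' (b' + 1) \<le> cube_degsum (a' + (b' + 1))"
        using IH[of a' b'] IH[of a' "b' + 1"] 2 4 by simp_all
      define u v where "u = min a' b'" and "v = min a' (b' + 1)"
      have "min a b = u + v" using 2 unfolding u_def v_def by (simp add: min_def)
      then show ?thesis using i2 unfolding e f u_def[symmetric] v_def[symmetric] by simp
    next
      case 3
      have e: "cube_degsum (a + b) = cube_degsum (a' + b') + cube_degsum (a' + 1 + b') + 2 * (a' + b')"
        using cube_degsum_odd[of "a' + b'"] 3 by (simp add: algebra_simps)
      have f: "cube_degsum b = 2 * cube_degsum b' + 2 * b'" "cube_degsum a = cube_degsum a' + cube_degsum (a' + 1) + 2 * a'"
        unfolding 3(1)[THEN arg_cong[where f=cube_degsum]] 3(2)[THEN arg_cong[where f=cube_degsum]] cube_degsum_even cube_degsum_odd by auto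
      have i2: "cube_degsum a' + cube_degsum b' + 2 * min a' b' \<le> cube_degsum (a' + b')"
        "cube_degsum (a' + 1) + cube_degsum b' + 2 * min (a' + 1) b' \<le> cube_degsum (a' + 1 + b')"
        using IH[of a' b'] IH[of "a' + 1" b'] 3 4 by simp_all
      define u v where "u = min a' b'" and "v = min (a' + 1) b'"
      have "min a b = u + v" using 3 unfolding u_def v_def by (simp add: min_def)
      then show ?thesis using i2 unfolding e f u_def[symmetric] v_def[symmetric] by simp
    next
      case 4
      have e: "cube_degsum (a + b) = 2 * cube_degsum (a' + b' + 1) + 2 * (a' + b' + 1)"
        using cube_degsum_even[of "a' + b' + 1"] 4 by (simp add: algebra_simps)
      have f: "cube_degsum b = cube_degsum b' + cube_degsum (b' + 1) + 2 * b'" "cube_degsum a = cube_degsum a' + cube_degsum (a' + 1) + 2 * a'"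
        unfolding 4(1)[THEN arg_cong[where f=cube_degsum]] 4(2)[THEN arg_cong[where f=cube_degsum]] cube_degsum_even cube_degsum_odd by auto
      \<comment> \<open>Both halves of \<open>a + b\<close> are \<open>a' + b' + 1\<close>, so a
        larger half is paired with a smaller one. This may lose one edge, which the term
        \<open>2 * (a' + b' + 1)\<close> makes up for.\<close>
      have g: "cube_degsum a' + cube_degsum (b' + 1) + 2 * min a' (b' + 1) \<le> cube_degsum (a' + b' + 1)"
        "cube_degsum (a' + 1) + cube_degsum b' + 2 * min (a' + 1) b' \<le> cube_degsum (a' + b' + 1)"
        using IH[of a' "b' + 1"] IH[of "a' + 1" b'] 4 \<open>a + b > 2\<close>
          by (simp_all add: algebra_simps)
      define u v where "u = min a' (b' + 1)" and "v = min (a' + 1) b'"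
      have "min a b \<le> u + v + 1" using 4 unfolding u_def v_def by (simp add: min_def)
      then show ?thesis using g unfolding e f u_def[symmetric] v_def[symmetric] by simp
    qed
  qed auto
qed

text \<open>A subcube of dimension \<open>d\<close> and an optimal set of size \<open>s\<close> in a
  neighbouring subcube form an optimal set: the subcube contributes \<open>d * 2 ^ d\<close>, and
  each of the \<open>s\<close> edges between the two counts twice.\<close>

lemma cube_degsum_power2_add: "s \<le> 2 ^ d \<Longrightarrow> cube_degsum (2 ^ d + s) = d * 2 ^ d + cube_degsum s + 2 * s"
proof (induction d arbitrary: s)
  case 0
  have "cube_degsum (2 * 1) = 2" by (subst cube_degsum_even) simp
  moreover have "s = 0 \<or> s = 1" using 0 by auto
  ultimately show ?case by (auto simp: numeral_2_eq_2)
next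
  case (Suc d)
  define t where "t = s div 2"
  consider "s = 2 * t" | "s = 2 * t + 1" unfolding t_def by linarith
  then show ?case
  proof cases
    case 1
    have "2 ^ Suc d + s = 2 * (2 ^ d + t)" using 1 by simp
    then show ?thesis
      using Suc.IH[of t] Suc.prems 1 cube_degsum_even[of t] cube_degsum_even[of "2 ^ d + t"] by simp
  next
    case 2
    have e: "2 ^ Suc d + s = 2 * (2 ^ d + t) + 1" using 2 by simp
    have f: "t + 1 \<le> 2 ^ d" using Suc.prems 2 by simp
    show ?thesis
      unfolding e
        using Suc.IH[of t] Suc.IH[OF f] f 2 cube_degsum_odd[of t] cube_degsum_odd[of "2 ^ d + t"]
      by (simp add: algebra_simps)
  qed
qed

text \<open>A set and its complement in the cube of dimension \<open>d\<close> have the same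
  boundary; for optimal sets this makes \<open>d * s - cube_degsum s\<close> symmetric under
  replacing \<open>s\<close> by \<open>2 ^ d - s\<close>. The correction term can be negative, hence
  the integers.\<close>

lemma cube_degsum_power2_diff:
  "s \<le> 2 ^ d \<Longrightarrow> int (cube_degsum s) = int (cube_degsum (2 ^ d - s)) + int d * (2 * int s - 2 ^ d)"
proof (induction d arbitrary: s)
  case 0
  then have "s = 0 \<or> s = 1" by auto
  then show ?case by auto
next
  case (Suc d)
  define t where "t = s div 2"
  consider "s = 2 * t" | "s = 2 * t + 1" unfolding t_def by linarith
  then show ?case
  proof cases
    case 1
    have t: "t \<le> 2 ^ d" using Suc.prems 1 by simp
    have "2 ^ Suc d - s = 2 * (2 ^ d - t)" using 1 by simp
    then show ?thesis using Suc.IH[OF t] t 1 cube_degsum_even[of t] cube_degsum_even[of "2 ^ d - t"]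
      by (simp add: algebra_simps of_nat_diff)
  next
    case 2
    have t: "t + 1 \<le> 2 ^ d" using Suc.prems 2 by simp
    have e: "2 ^ Suc d - s = 2 * (2 ^ d - (t + 1)) + 1" using 2 t by simp
    have f: "2 ^ d - (t + 1) + 1 = 2 ^ d - t" using t by simp
    show ?thesis
      unfolding e cube_degsum_odd f unfolding 2 cube_degsum_odd using Suc.IH[OF t] Suc.IH[of t] t
      by (simp add: algebra_simps of_nat_diff)
  qed
qed

text \<open>All degrees in the cube of dimension \<open>d\<close> are at most
  \<open>d\<close>.\<close>

lemma cube_degsum_le: "s \<le> 2 ^ d \<Longrightarrow> cube_degsum s \<le> d * s"
proof (induction d arbitrary: s)
  case 0
  then have "s = 0 \<or> s = 1" by auto
  then show ?case by auto
next
  case (Suc d)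
  show ?case
  proof (cases "s \<le> 2 ^ d")
    case True
    then show ?thesis using Suc.IH[of s] by simp
  next
    case False
    then obtain r where r: "s = 2 ^ d + r" "r \<le> 2 ^ d"
      using Suc.prems by (metis add_le_cancel_left le_iff_add linear mult_2 power_Suc)
    then show ?thesis using cube_degsum_power2_add[of r d] Suc.IH[of r] by (simp add: algebra_simps)
  qed
qed

text \<open>A set that fits into a subcube of codimension 4 has at least 4 boundary edges per
  vertex. For larger \<open>r\<close>, splitting off \<open>2 ^ (k - 4)\<close> leaves
  \<open>s\<close> with \<open>12 * s \<le> 2 ^ (k - 2)\<close>, so induction gives
  \<open>cube_degsum s \<le> (k - 6) * s\<close>, and the \<open>2 * s\<close> from the connecting
  edges raises the factor to \<open>k - 4\<close>.\<close>

lemma cube_degsum_le_codim4: "12 * r \<le> 2 ^ k \<Longrightarrow> cube_degsum r + 4 * r \<le> k * r"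
proof (induction k arbitrary: r rule: less_induct)
  case (less k)
  show ?case
  proof (cases "r = 0")
    case False
    have k: "k \<ge> 4"
    proof (rule ccontr)
      assume "\<not> k \<ge> 4"
      then have "(2::nat) ^ k \<le> 2 ^ 3" by (intro power_increasing) auto
      then show False using less.prems False by simp
    qed
    then have p: "(2::nat) ^ k = 16 * 2 ^ (k - 4)"
      using power_add[of "2::nat" 4 "k - 4"] by simp
    obtain j where j: "k = j + 4" using k by (metis le_add_diff_inverse2)
    show ?thesis
    proof (cases "r \<le> 2 ^ (k - 4)")
      case True
      then show ?thesis using cube_degsum_le[OF True] j by (simp add: algebra_simps)
    next
      case False
      define s where "s = r - 2 ^ (k - 4)"
      have s: "r = 2 ^ (k - 4) + s" "s > 0" using False unfolding s_def by auto
      have s3: "3 * s \<le> 2 ^ (k - 4)" using less.prems s p by simp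
      have "k \<ge> 6"
      proof (rule ccontr)
        assume "\<not> k \<ge> 6"
        then have "(2::nat) ^ (k - 4) \<le> 2 ^ 1" using k by (intro power_increasing) auto
        then show False using s3 s by simp
      qed
      then obtain i where i: "k = i + 6" by (metis le_add_diff_inverse2)
      have "cube_degsum s + 4 * s \<le> (k - 2) * s"
        using less.IH[of "k - 2" s] s3 i by (simp add: power_add)
      moreover have "cube_degsum r = (k - 4) * 2 ^ (k - 4) + cube_degsum s + 2 * s"
        using cube_degsum_power2_add[of s "k - 4"] s3 s by simp
      ultimately show ?thesis unfolding s(1) using i by (simp add: algebra_simps)
    qed
  qed simp
qed

section \<open>Families of sets as vertex sets of Cayley graphs\<close>

definition flip :: "'a set \<Rightarrow> 'a set \<Rightarrow> 'a set" where
  "flip g x = (x - g) \<union> (g - x)"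

text \<open>For nonempty \<open>g\<close>, an edge inside \<open>S\<close> in direction
  \<open>g\<close> is counted at both endpoints, while a boundary edge contributes one point to
  \<open>leaving g S\<close>. Sums over directions are thus degree sums and boundary sizes
  respectively.\<close>

definition staying :: "'a set \<Rightarrow> 'a set set \<Rightarrow> 'a set set" where
  "staying g S = {x \<in> S. flip g x \<in> S}"

definition leaving :: "'a set \<Rightarrow> 'a set set \<Rightarrow> 'a set set" where
  "leaving g S = {x \<in> S. flip g x \<notin> S}"

definition degsum :: "'a set \<Rightarrow> 'a set set \<Rightarrow> nat" where
  "degsum I S = (\<Sum>i\<in>I. card (staying {i} S))"

lemma flip_flip [simp]: "flip g (flip g x) = x"
  unfolding flip_def by auto

lemma inj_flip: "inj_on (flip g) S"
  by (metis flip_flip inj_onI)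

lemma flip_Pow: "x \<subseteq> I \<Longrightarrow> g \<subseteq> I \<Longrightarrow> flip g x \<subseteq> I"
  unfolding flip_def by auto

lemma flip_self: "x \<subseteq> J \<Longrightarrow> flip J x = J - x"
  unfolding flip_def by auto

lemma card_staying_leaving: "finite S \<Longrightarrow> card (staying g S) + card (leaving g S) = card S"
proof -
  assume "finite S"
  moreover have "staying g S \<union> leaving g S = S" "staying g S \<inter> leaving g S = {}"
    unfolding staying_def leaving_def by auto
  ultimately show ?thesis by (metis card_Un_disjoint finite_Un)
qed

text \<open>The map \<open>flip g\<close> exchanges the two endpoints of each boundary edge.\<close>

lemma card_leaving_compl:
  assumes "S \<subseteq> Pow I" "g \<subseteq> I"
  shows "card (leaving g (Pow I - S)) = card (leaving g S)"
proof -
  have "leaving g (Pow I - S) = flip g ` leaving g S"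
  proof (intro set_eqI iffI)
    fix x assume "x \<in> leaving g (Pow I - S)"
    then have "flip g x \<in> leaving g S"
      using assms flip_Pow[of x I g] unfolding leaving_def by auto
    then show "x \<in> flip g ` leaving g S" by (metis flip_flip image_eqI)
  next
    fix x assume "x \<in> flip g ` leaving g S"
    then obtain y where y: "x = flip g y" "y \<in> S" "flip g y \<notin> S"
      unfolding leaving_def by auto
    then have "x \<subseteq> I" using assms by (metis PowD flip_Pow subsetD)
    then show "x \<in> leaving g (Pow I - S)" using y unfolding leaving_def by simp
  qed
  then show ?thesis by (simp add: card_image inj_flip)
qed

text \<open>An edge inside \<open>A\<close> or inside \<open>B\<close> lies inside the union, and
  one inside both lies inside the intersection.\<close>

lemma card_staying_supermodular:
  assumes "finite A" "finite B"
  shows "card (staying g A) + card (staying g B) \<le> card (staying g (A \<union> B)) + card (staying g (A \<inter> B))"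
proof -
  have fin: "finite (staying g A)" "finite (staying g B)" "finite (staying g (A \<union> B))"
    using assms unfolding staying_def by auto
  have "staying g A \<inter> staying g B = staying g (A \<inter> B)" unfolding staying_def by auto
  moreover have "card (staying g A \<union> staying g B) \<le> card (staying g (A \<union> B))"
    by (rule card_mono[OF fin(3)]) (auto simp: staying_def)
  ultimately show ?thesis using card_Un_Int[OF fin(1,2)] by simp
qed

section \<open>Splitting a family along a coordinate\<close>

definition lower :: "'a \<Rightarrow> 'a set set \<Rightarrow> 'a set set" where
  "lower i S = {x \<in> S. i \<notin> x}"

text \<open>The element \<open>i\<close> is removed so that both halves live in the same smaller
  cube; the edges in direction \<open>i\<close> then correspond to
  \<open>lower i S \<inter> upper i S\<close>.\<close>

definition upper :: "'a \<Rightarrow> 'a set set \<Rightarrow> 'a set set" where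
  "upper i S = {x. i \<notin> x \<and> insert i x \<in> S}"

lemma split_image: "S = lower i S \<union> insert i ` upper i S"
proof (intro set_eqI iffI)
  fix x assume x: "x \<in> S"
  show "x \<in> lower i S \<union> insert i ` upper i S"
  proof (cases "i \<in> x")
    case True
    then have "x - {i} \<in> upper i S" "x = insert i (x - {i})"
      using x by (auto simp: upper_def insert_absorb)
    then show ?thesis by (metis UnCI image_eqI)
  qed (use x in \<open>auto simp: lower_def\<close>)
qed (auto simp: lower_def upper_def)

lemma inj_insert_upper: "inj_on (insert i) {x. i \<notin> x}"
  by (rule inj_onI) (simp add: insert_ident)

lemma upper_Pow: "S \<subseteq> Pow I \<Longrightarrow> upper i S \<subseteq> Pow (I - {i})"
  unfolding upper_def by auto

lemma lower_Pow: "S \<subseteq> Pow I \<Longrightarrow> lower i S \<subseteq> Pow (I - {i})"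
  unfolding lower_def by auto

lemma finite_upper: assumes "finite S" shows "finite (upper i S)"
proof (rule finite_imageD)
  show "finite (insert i ` upper i S)"
    by (rule finite_subset[OF _ assms]) (auto simp: upper_def)
  show "inj_on (insert i) (upper i S)"
    by (rule inj_on_subset[OF inj_insert_upper]) (auto simp: upper_def)
qed

lemma finite_lower: "finite S \<Longrightarrow> finite (lower i S)"
  unfolding lower_def by auto

lemma card_split: assumes "finite S" shows "card S = card (lower i S) + card (upper i S)"
proof -
  have "card S = card (lower i S) + card (insert i ` upper i S)"
    by (subst split_image[of S i], rule card_Un_disjoint)
      (auto simp: finite_upper finite_lower assms, auto simp: lower_def)
  also have "card (insert i ` upper i S) = card (upper i S)"
    by (rule card_image, rule inj_on_subset[OF inj_insert_upper]) (auto simp: upper_def)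
  finally show ?thesis .
qed

lemma lower_staying: "i \<notin> g \<Longrightarrow> lower i (staying g S) = staying g (lower i S)"
  unfolding lower_def staying_def flip_def by auto

lemma flip_insert: "i \<notin> g \<Longrightarrow> i \<notin> x \<Longrightarrow> flip g (insert i x) = insert i (flip g x)"
  unfolding flip_def by auto

lemma upper_staying: "i \<notin> g \<Longrightarrow> upper i (staying g S) = staying g (upper i S)"
  unfolding upper_def staying_def by (auto simp: flip_insert) (auto simp: flip_def)

lemma finite_staying: "finite S \<Longrightarrow> finite (staying g S)"
  unfolding staying_def by auto

lemma card_staying_split:
  "finite S \<Longrightarrow> i \<notin> g \<Longrightarrow> card (staying g S) = card (staying g (lower i S)) + card (staying g (upper i S))"
  using card_split[of "staying g S" i] by (simp add: finite_staying lower_staying upper_staying)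

lemma card_staying_singleton:
  assumes "finite S" shows "card (staying {i} S) = 2 * card (lower i S \<inter> upper i S)"
proof -
  have "lower i (staying {i} S) = lower i S \<inter> upper i S"
    unfolding lower_def upper_def staying_def flip_def by auto
  moreover have "flip {i} (insert i x) = x" if "i \<notin> x" for x
    using that unfolding flip_def by auto
  then have "upper i (staying {i} S) = lower i S \<inter> upper i S"
    unfolding lower_def upper_def staying_def by auto
  ultimately show ?thesis using card_split[of "staying {i} S" i] by (simp add: finite_staying assms)
qed

lemma degsum_split:
  assumes "finite S" "finite I" "i \<in> I"
  shows "degsum I S = 2 * card (lower i S \<inter> upper i S)
     + degsum (I - {i}) (lower i S) + degsum (I - {i}) (upper i S)"
proof -
  have "degsum I S = card (staying {i} S) + (\<Sum>j\<in>I - {i}. card (staying {j} S))"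
    unfolding degsum_def using assms by (simp add: sum.remove)
  also have "(\<Sum>j\<in>I - {i}. card (staying {j} S))
     = (\<Sum>j\<in>I - {i}. card (staying {j} (lower i S)) + card (staying {j} (upper i S)))"
    by (rule sum.cong) (auto intro!: card_staying_split assms)
  finally show ?thesis
    unfolding card_staying_singleton[OF assms(1)] degsum_def by (simp add: sum.distrib)
qed

text \<open>In every direction \<open>S\<close> and its complement have equally many leaving
  members, so the numbers of staying members differ by the difference of the sizes. This is the
  counterpart for families of \<open>cube_degsum_power2_diff\<close>.\<close>

lemma degsum_compl:
  assumes "S \<subseteq> Pow I" "finite I"
  shows "int (degsum I S) = int (degsum I (Pow I - S)) + int (card I) * (2 * int (card S) - 2 ^ card I)"
proof -
  have fin: "finite S" "finite (Pow I - S)" using assms finite_subset by auto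
  have c: "int (card (Pow I - S)) = 2 ^ card I - int (card S)"
    using assms card_mono[of "Pow I" S] by (simp add: card_Diff_subset fin card_Pow of_nat_diff)
  have "int (card (staying {i} S)) = int (card (staying {i} (Pow I - S))) + (2 * int (card S) - 2 ^ card I)"
    if "i \<in> I" for i
    using card_staying_leaving[OF fin(1), of "{i}"] card_staying_leaving[OF fin(2), of "{i}"]
      card_leaving_compl[OF assms(1), of "{i}"] that c by simp
  then have "(\<Sum>i\<in>I. int (card (staying {i} S)))
      = (\<Sum>i\<in>I. int (card (staying {i} (Pow I - S))) + (2 * int (card S) - 2 ^ card I))"
    by (intro sum.cong) auto
  then show ?thesis unfolding degsum_def by (simp add: sum.distrib)
qed

section \<open>Complement-closed families\<close>

text \<open>Unions of antipodal pairs, that is, preimages of vertex sets of the folded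
  hypercube.\<close>

definition sym_family :: "'a set \<Rightarrow> 'a set set \<Rightarrow> bool" where
  "sym_family I S \<longleftrightarrow> S \<subseteq> Pow I \<and> (\<forall>x\<in>S. I - x \<in> S)"

lemma inj_on_compl: "S \<subseteq> Pow I \<Longrightarrow> inj_on (\<lambda>x. I - x) S"
  by (rule inj_onI) (metis Pow_iff double_diff order_refl subsetD)

lemma sym_family_upper:
  assumes "sym_family I S" "i \<in> I"
  shows "upper i S = (\<lambda>x. I - {i} - x) ` lower i S"
proof (intro set_eqI iffI)
  fix x assume "x \<in> upper i S"
  then have x: "i \<notin> x" "insert i x \<in> S" "insert i x \<subseteq> I"
    using assms unfolding upper_def sym_family_def by auto
  then have "I - insert i x \<in> lower i S" using assms unfolding lower_def sym_family_def by auto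
  moreover have "x = I - {i} - (I - insert i x)" using x by auto
  ultimately show "x \<in> (\<lambda>x. I - {i} - x) ` lower i S" by blast
next
  fix x assume "x \<in> (\<lambda>x. I - {i} - x) ` lower i S"
  then obtain y where y: "x = I - {i} - y" "i \<notin> y" "y \<in> S" unfolding lower_def by auto
  then have "insert i x = I - y" using assms by auto
  then show "x \<in> upper i S" using y assms unfolding upper_def sym_family_def by auto
qed

lemma sym_family_card:
  assumes "sym_family I S" "finite I" "i \<in> I"
  shows "card (upper i S) = card (lower i S)" "card S = 2 * card (lower i S)"
proof -
  have S: "S \<subseteq> Pow I" "finite S"
    using assms finite_subset unfolding sym_family_def by auto
  show "card (upper i S) = card (lower i S)"
    unfolding sym_family_upper[OF assms(1,3)]
    by (rule card_image, rule inj_on_compl, rule lower_Pow[OF S(1)])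
  then show "card S = 2 * card (lower i S)" using card_split[OF S(2), of i] by simp
qed

text \<open>Complementation in \<open>I - {i}\<close> exchanges the two halves and so preserves
  their intersection and union. An induction on the dimension can therefore continue with these two,
  whereas the halves themselves need not be complement-closed.\<close>

lemma sym_family_Int_Un:
  assumes "sym_family I S" "i \<in> I"
  shows "sym_family (I - {i}) (lower i S \<inter> upper i S)" "sym_family (I - {i}) (lower i S \<union> upper i S)"
proof -
  have S: "S \<subseteq> Pow I" using assms unfolding sym_family_def by auto
  have l: "lower i S \<subseteq> Pow (I - {i})" by (rule lower_Pow[OF S])
  have u: "upper i S \<subseteq> Pow (I - {i})" by (rule upper_Pow[OF S])
  have a: "I - {i} - x \<in> upper i S" if "x \<in> lower i S" for x
    using that sym_family_upper[OF assms] by auto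
  have b: "I - {i} - x \<in> lower i S" if xu: "x \<in> upper i S" for x
  proof -
    obtain y where "y \<in> lower i S" "x = I - {i} - y" using xu sym_family_upper[OF assms] by auto
    moreover then have "I - {i} - x = y" using l by auto
    ultimately show ?thesis by simp
  qed
  show "sym_family (I - {i}) (lower i S \<inter> upper i S)"
    using a b l unfolding sym_family_def by auto
  show "sym_family (I - {i}) (lower i S \<union> upper i S)"
    using a b l u unfolding sym_family_def by auto
qed

lemma sym_family_compl: assumes "sym_family I S" shows "sym_family I (Pow I - S)"
proof -
  have "I - x \<notin> S" if "x \<subseteq> I" "x \<notin> S" for x
    using assms that double_diff[OF that(1) order_refl] unfolding sym_family_def by metis
  then show ?thesis unfolding sym_family_def by auto
qed

lemma sym_family_finite: "sym_family I S \<Longrightarrow> finite I \<Longrightarrow> finite S"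
  unfolding sym_family_def using finite_subset by auto

lemma sym_family_even:
  assumes "sym_family I S" "finite I" "I \<noteq> {}"
  shows "even (card S)"
proof -
  obtain i where "i \<in> I" using assms by auto
  then show ?thesis using sym_family_card(2)[OF assms(1,2)] by auto
qed

text \<open>
  Split \<open>S\<close> along a coordinate \<open>i\<close> into \<open>A = lower i S\<close> and
  \<open>B = upper i S\<close>. As \<open>B\<close> consists of the complements of the members of \<open>A\<close>, the families
  \<open>A \<union> B\<close> and \<open>A \<inter> B\<close> are again complement-closed, of sizes \<open>2w\<close> and \<open>2p\<close> with
  \<open>w + p = t\<close>, and supermodularity allows the induction hypothesis to be applied to them.
  If \<open>w\<close> exceeds the admissible size \<open>N = 2 ^ d\<close>, it is applied to the complementary family of
  \<open>A \<union> B\<close> instead; this loses \<open>w - N\<close>, which is affordable if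
  \<open>w - N \<le> p\<close>.
  If no coordinate achieves this, then so many edges leave \<open>S\<close> in every direction that the
  bound is trivial.
\<close>

lemma degsum_sym_family_le:
  assumes "finite I" "card I = d + 2" "sym_family I S" "card S = 2 * t" "t \<le> 2 ^ d"
  shows "degsum I S \<le> 2 * cube_degsum t"
  using assms
proof (induction d arbitrary: I S t)
  case 0
  show ?case
  proof (cases "t = 0")
    case True
    then have "S = {}" using 0 sym_family_finite[of I S] by simp
    then show ?thesis by (simp add: degsum_def staying_def)
  next
    case False
    \<comment> \<open>An antipodal pair in a square spans no edge: the two halves have one member
      each, and their intersection has even size.\<close>
    have *: "card (staying {i} S) = 0" if i: "i \<in> I" for i
    proof -
      have fS: "finite S" using 0 sym_family_finite by blast
      let ?J = "I - {i}"
      have sf: "sym_family ?J (lower i S \<inter> upper i S)"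
        using sym_family_Int_Un[OF 0(3) i] by simp
      have fin: "finite (lower i S)" using finite_lower[OF fS] .
      have "card ?J = 1" using 0 i by simp
      then have "?J \<noteq> {}" by (metis card.empty zero_neq_one)
      then have "even (card (lower i S \<inter> upper i S))"
        using sym_family_even[OF sf] 0(1) by simp
      moreover have "card (lower i S \<inter> upper i S) \<le> card (lower i S)"
        by (rule card_mono) (auto simp: fin)
      moreover have "card (lower i S) \<le> 1" using sym_family_card(2)[OF 0(3,1) i] 0 by simp
      ultimately have "card (lower i S \<inter> upper i S) = 0"
        by (metis One_nat_def dvd_1_iff_1 even_zero le_Suc_eq le_zero_eq odd_one order_trans)
      then show ?thesis using card_staying_singleton[OF fS] by simp
    qed
    show ?thesis unfolding degsum_def using * by simp
  qed
next
  case (Suc d)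
  let ?N = "2 ^ d :: nat"
  note I = Suc.prems(1,2) and sf = Suc.prems(3) and cS = Suc.prems(4)
  have fS: "finite S" using sf I sym_family_finite by blast
  have main: ?case if i: "i \<in> I" and small: "t \<le> ?N \<or> card (leaving {i} S) \<le> 2 * ?N"
    for i
  proof -
    let ?J = "I - {i}"
    let ?A = "lower i S" and ?B = "upper i S"
    have J: "finite ?J" "card ?J = d + 2" using I i by simp_all
    then have Jne: "?J \<noteq> {}" by (metis card.empty add_is_0 zero_neq_numeral)
    have fin: "finite ?A" "finite ?B" using finite_lower[OF fS] finite_upper[OF fS] by auto
    note sfI = sym_family_Int_Un(1)[OF sf i] and sfU = sym_family_Int_Un(2)[OF sf i]
    obtain p where p: "card (?A \<inter> ?B) = 2 * p"
      using sym_family_even[OF sfI J(1) Jne] by (rule evenE)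
    obtain w where w: "card (?A \<union> ?B) = 2 * w"
      using sym_family_even[OF sfU J(1) Jne] by (rule evenE)
    have cA: "card ?A = t" "card ?B = t" using sym_family_card[OF sf I(1) i] cS by simp_all
    have wp: "w + p = t" using card_Un_Int[OF fin] cA p w by simp
    have pw: "p \<le> w"
      using card_mono[of "?A \<union> ?B" "?A \<inter> ?B"] fin p w by (simp add: le_infI1)
    have E: "degsum I S \<le> 4 * p + degsum ?J (?A \<union> ?B) + degsum ?J (?A \<inter> ?B)"
    proof -
      have "degsum ?J ?A + degsum ?J ?B \<le> degsum ?J (?A \<union> ?B) + degsum ?J (?A \<inter> ?B)"
        unfolding degsum_def sum.distrib[symmetric]
          by (intro sum_mono card_staying_supermodular fin)
      then show ?thesis unfolding degsum_split[OF fS I(1) i] p by simp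
    qed
    have tN: "t \<le> 2 * ?N" using Suc.prems by simp
    have EI: "degsum ?J (?A \<inter> ?B) \<le> 2 * cube_degsum p"
      by (rule Suc.IH[OF J sfI p]) (use tN wp pw in simp)
    show ?thesis
    proof (cases "w \<le> ?N")
      case True
      have "degsum ?J (?A \<union> ?B) \<le> 2 * cube_degsum w" by (rule Suc.IH[OF J sfU w True])
      moreover have "cube_degsum w + cube_degsum p + 2 * p \<le> cube_degsum t"
        using cube_degsum_superadd[of w p] wp pw by simp
      ultimately show ?thesis using E EI by simp
    next
      case False
      define \<delta> where "\<delta> = w - ?N"
      have \<delta>: "w = ?N + \<delta>" using False unfolding \<delta>_def by simp
      have \<delta>N: "\<delta> + p \<le> ?N" using tN wp \<delta> by simp
      \<comment> \<open>The left side counts the members leaving \<open>S\<close> in direction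
        \<open>i\<close> and equals \<open>2 * (w - p)\<close>, so the bound amounts to
        \<open>w - ?N \<le> p\<close>. The alternative \<open>t \<le> ?N\<close> is excluded by
        \<open>?N < w \<le> t\<close>.\<close>
      have "2 * t - 4 * p \<le> 2 * ?N"
        using small card_staying_leaving[OF fS, of "{i}"] card_staying_singleton[OF fS, of i] p cS wp False by auto
      then have \<delta>p: "\<delta> \<le> p" using wp \<delta> by simp
      let ?W = "?A \<union> ?B" and ?W' = "Pow ?J - (?A \<union> ?B)"
      have WP: "?W \<subseteq> Pow ?J" using sfU unfolding sym_family_def by simp
      have card_P: "card (Pow ?J) = 4 * ?N" using J by (simp add: card_Pow)
      have "card ?W' = 2 * (?N - \<delta>)"
        using card_Diff_subset[of ?W "Pow ?J"] WP fin card_P w \<delta> by simp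
      then have W': "degsum ?J ?W' \<le> 2 * cube_degsum (?N - \<delta>)"
        by (intro Suc.IH[OF J sym_family_compl[OF sfU]]) simp_all
      \<comment> \<open>The family is complemented in dimension \<open>d + 2\<close>, but
        \<open>w\<close> only in \<open>2 ^ (d + 1)\<close>. The corrections
        \<open>4 * (d + 2) * \<delta>\<close> and, after doubling,
        \<open>4 * (d + 1) * \<delta>\<close> differ by the loss
        \<open>4 * \<delta>\<close>.\<close>
      have d1: "int (degsum ?J ?W) = int (degsum ?J ?W') + int (d + 2) * (4 * int \<delta>)"
        using degsum_compl[OF WP J(1)] J(2) w \<delta> by simp
      have d2: "int (cube_degsum w) = int (cube_degsum (?N - \<delta>)) + int (d + 1) * (2 * int \<delta>)"
        using cube_degsum_power2_diff[of w "d + 1"] \<delta> \<delta>N by simp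
      have "int (degsum ?J ?W) \<le> 2 * int (cube_degsum w) + 4 * int \<delta>"
        using d1 d2 W' by (simp add: algebra_simps)
      then have EW: "degsum ?J ?W \<le> 2 * cube_degsum w + 4 * \<delta>" by linarith
      \<comment> \<open>Splitting \<open>?N\<close> off both \<open>w\<close> and \<open>t\<close>
        leaves \<open>\<delta>\<close> and \<open>\<delta> + p\<close>. Superadditivity there gains
        \<open>2 * \<delta>\<close> because \<open>\<delta> \<le> p\<close>, and twice this pays for
        the loss.\<close>
      have d3: "cube_degsum w = d * ?N + cube_degsum \<delta> + 2 * \<delta>"
        using cube_degsum_power2_add[of \<delta> d] \<delta> \<delta>N by simp
      have d4: "cube_degsum t = d * ?N + cube_degsum (\<delta> + p) + 2 * (\<delta> + p)"
        using cube_degsum_power2_add[OF \<delta>N] \<delta> wp by (simp add: algebra_simps)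
      have d5: "cube_degsum \<delta> + cube_degsum p + 2 * \<delta> \<le> cube_degsum (\<delta> + p)" using cube_degsum_superadd[of \<delta> p] \<delta>p by simp
      show ?thesis using E EI EW d3 d4 d5 by simp
    qed
  qed
  show ?case
  proof (cases "t \<le> ?N \<or> (\<exists>i\<in>I. card (leaving {i} S) \<le> 2 * ?N)")
    case True
    have "I \<noteq> {}" using I(2) by (metis card.empty add_is_0 zero_neq_numeral)
    then show ?thesis using True main by blast
  next
    case False
    define s where "s = t - ?N"
    have s: "t = ?N + s" using False unfolding s_def by simp
    have sN: "s \<le> ?N" using Suc.prems(5) s by simp
    have s0: "s > 0" using False s by simp
    \<comment> \<open>The number is even and strictly less than
      \<open>2 * t - 2 * ?N = 2 * s\<close>.\<close>
    have "card (staying {i} S) \<le> 2 * (s - 1)" if i: "i \<in> I" for i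
    proof -
      have "card (staying {i} S) + card (leaving {i} S) = 2 * t"
        using card_staying_leaving[OF fS] cS by simp
      moreover have "card (leaving {i} S) > 2 * ?N" using False i by auto
      moreover have "card (staying {i} S) = 2 * card (lower i S \<inter> upper i S)"
        by (rule card_staying_singleton[OF fS])
      ultimately show ?thesis using s by simp
    qed
    then have "degsum I S \<le> card I * (2 * (s - 1))"
      unfolding degsum_def
        using sum_bounded_above[of I "\<lambda>i. card (staying {i} S)" "2 * (s - 1)"] by simp
    moreover have "card I = d + 3" using I by simp
    ultimately have "degsum I S \<le> (d + 3) * (2 * (s - 1))" by simp
    then have a: "int (degsum I S) \<le> int (d + 3) * (2 * (int s - 1))"
    proof -
      obtain r where "s = Suc r" using s0 by (cases s) auto
      then have "int (degsum I S) \<le> int ((d + 3) * (2 * r))"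
        using \<open>degsum I S \<le> (d + 3) * (2 * (s - 1))\<close> by (subst of_nat_le_iff) simp
      then show ?thesis using \<open>s = Suc r\<close> by simp
    qed
    \<comment> \<open>Dropping the nonnegative \<open>cube_degsum (2 ^ d - s)\<close> leaves a
      linear bound. It then suffices that \<open>s \<le> d * s + 1\<close>; for \<open>d = 0\<close>
      this holds because \<open>s \<le> 1\<close>.\<close>
    have "int (cube_degsum s) \<ge> int d * (2 * int s - 2 ^ d)"
      using cube_degsum_power2_diff[OF sN] by simp
    moreover have "cube_degsum t = d * ?N + cube_degsum s + 2 * s"
      using cube_degsum_power2_add[OF sN] s by simp
    ultimately have b: "int (cube_degsum t) \<ge> 2 * int d * int s + 2 * int s"
      by (simp add: algebra_simps)
    have "int d * int s \<ge> 0" by simp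
    moreover have "d = 0 \<Longrightarrow> s \<le> 1" using sN by simp
    then have "d \<ge> 1 \<or> s \<le> 1" by linarith
    then have "int s \<le> int d * int s + 1"
      using s0 by (cases d) (auto simp: algebra_simps)
    ultimately have "int (degsum I S) \<le> 2 * int (cube_degsum t)"
      using a b by (simp add: algebra_simps)
    then show ?thesis by linarith
  qed
qed

text \<open>
  The folded hypercube of dimension \<open>m\<close> is the quotient of the hypercube of dimension
  \<open>m + 1\<close> by complementation; a vertex set \<open>A\<close> is lifted to its preimage.
\<close>

lemma folded_degsum_le:
  fixes A :: "nat set set"
  assumes "A \<subseteq> Pow {..<m}" "card A \<le> 2 ^ (m - 1)" "m \<ge> 1"
  shows "card (staying {..<m} A) + degsum {..<m} A \<le> cube_degsum (card A)"
proof -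
  let ?I = "{..m}"
  let ?C = "(\<lambda>x. {..<m} - x) ` A"
  \<comment> \<open>The new coordinate \<open>m\<close> distinguishes the two preimages of a vertex:
    members of \<open>A\<close> form the lower half, their complements in \<open>{..<m}\<close> the
    upper half.\<close>
  define S where "S = A \<union> insert m ` ?C"
  have fA: "finite A" using assms finite_subset by blast
  have fS: "finite S" unfolding S_def using fA by simp
  have eq: "insert m ({..<m} - x) = ?I - x" if "x \<in> A" for x using assms that by auto
  then have eq': "insert m ` ?C = (\<lambda>x. ?I - x) ` A" by (force simp: image_iff)
  have sf: "sym_family ?I S"
    unfolding sym_family_def S_def eq'
  proof (intro conjI ballI)
    show "A \<union> (\<lambda>x. ?I - x) ` A \<subseteq> Pow ?I" using assms(1) by fastforce
    fix x assume "x \<in> A \<union> (\<lambda>x. ?I - x) ` A"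
    then consider "x \<in> A" | y where "y \<in> A" "x = ?I - y" by auto
    then show "?I - x \<in> A \<union> (\<lambda>x. ?I - x) ` A"
    proof cases
      case 2
      then have "?I - x = y" using assms(1) by (force)
      then show ?thesis using 2 by simp
    qed auto
  qed
  have low: "lower m S = A" using assms(1) unfolding S_def lower_def by auto
  have up: "upper m S = ?C"
    unfolding sym_family_upper[OF sf, of m, simplified] low
      by (simp add: atMost_Suc lessThan_Suc_atMost[symmetric] lessThan_Suc)
  have del: "?I - {m} = {..<m}" by auto
  have cS: "card S = 2 * card A" using sym_family_card(2)[OF sf, of m] low by simp
  obtain d where d: "m = d + 1" using assms(3) by (metis le_add_diff_inverse2)
  have le: "degsum ?I S \<le> 2 * cube_degsum (card A)"
    by (rule degsum_sym_family_le[OF _ _ sf cS, of d]) (use d assms in simp_all)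
  have "staying {..<m} A = A \<inter> ?C"
  proof -
    have "flip {..<m} x \<in> A \<longleftrightarrow> x \<in> ?C" if "x \<in> A" for x
    proof -
      have xs: "x \<subseteq> {..<m}" using that assms by auto
      have "x \<in> ?C \<longleftrightarrow> {..<m} - x \<in> A"
      proof
        assume "x \<in> ?C"
        then obtain y where "y \<in> A" "x = {..<m} - y" by auto
        then show "{..<m} - x \<in> A" using assms(1) double_diff[of y "{..<m}"] by auto
      next
        assume "{..<m} - x \<in> A"
        then show "x \<in> ?C" using double_diff[OF xs order_refl] by (metis image_eqI)
      qed
      then show ?thesis using flip_self[OF xs] by simp
    qed
    then show ?thesis unfolding staying_def by auto
  qed
  moreover have "card (staying {j} ?C) = card (staying {j} A)" if "j < m" for j
  proof -
    have fl: "flip {j} ({..<m} - x) = {..<m} - flip {j} x" if "x \<subseteq> {..<m}" for x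
      using that \<open>j < m\<close> unfolding flip_def by auto
    have mem: "{..<m} - x \<in> ?C \<longleftrightarrow> x \<in> A" if "x \<subseteq> {..<m}" for x
      using that assms(1) double_diff[OF _ order_refl, of _ "{..<m}"]
        by (smt (verit) Pow_iff image_iff subsetD)
    have "staying {j} ?C = (\<lambda>x. {..<m} - x) ` staying {j} A"
    proof (intro set_eqI iffI)
      fix y assume "y \<in> staying {j} ?C"
      then obtain x where x: "x \<in> A" "y = {..<m} - x" "flip {j} y \<in> ?C"
        unfolding staying_def by auto
      have xs: "x \<subseteq> {..<m}" using x assms by auto
      have "flip {j} x \<subseteq> {..<m}"
        using flip_Pow[OF xs, of "{j}"] \<open>j < m\<close> by simp
      then have "flip {j} x \<in> A" using x fl[OF xs] mem by simp
      then show "y \<in> (\<lambda>x. {..<m} - x) ` staying {j} A"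
        using x unfolding staying_def by auto
    next
      fix y assume "y \<in> (\<lambda>x. {..<m} - x) ` staying {j} A"
      then obtain x where x: "x \<in> A" "y = {..<m} - x" "flip {j} x \<in> A"
        unfolding staying_def by auto
      have xs: "x \<subseteq> {..<m}" using x assms by auto
      show "y \<in> staying {j} ?C" using x fl[OF xs] unfolding staying_def by auto
    qed
    moreover have "inj_on (\<lambda>x. {..<m} - x) (staying {j} A)"
      by (rule inj_on_compl) (use assms(1) in \<open>auto simp: staying_def\<close>)
    ultimately show ?thesis by (simp add: card_image)
  qed
  then have "degsum {..<m} ?C = degsum {..<m} A" unfolding degsum_def by (intro sum.cong) auto
  \<comment> \<open>Direction \<open>m\<close> of the lift accounts for the complementary edges
    inside \<open>A\<close>, and the halves have equal degree sums. So the lift has twice the degree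
    sum of \<open>A\<close> in the folded hypercube.\<close>
  moreover have "degsum ?I S = 2 * card (A \<inter> ?C) + degsum {..<m} A + degsum {..<m} ?C"
    using degsum_split[OF fS, of ?I m] unfolding low up del by simp
  ultimately show ?thesis using le by simp
qed

section \<open>Boundaries in the enhanced hypercube\<close>

text \<open>For a family over \<open>{..<Suc m}\<close> this counts the boundary edges within the
  two copies of the folded hypercube, leaving out the matching.\<close>

definition folded_boundary_size :: "nat \<Rightarrow> nat set set \<Rightarrow> nat" where
  "folded_boundary_size m A = card (leaving {..<m} A) + (\<Sum>j<m. card (leaving {j} A))"

text \<open>
  With bit \<open>x\<^sub>i\<close> as membership of \<open>i - 1\<close>, the graph \<open>Q\<^sub>n\<^sub>,\<^sub>2\<close> is the Cayley graph
  of \<open>Pow {..<n}\<close> under symmetric difference with these generators.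
\<close>

definition generators :: "nat \<Rightarrow> nat set set" where
  "generators n = insert {..<n - 1} ((\<lambda>i. {i}) ` {..<n})"

definition boundary_size :: "nat \<Rightarrow> nat set set \<Rightarrow> nat" where
  "boundary_size n X = (\<Sum>g\<in>generators n. card (leaving g X))"

lemma boundary_size_eq:
  assumes "m \<ge> 2"
  shows "boundary_size (Suc m) X = folded_boundary_size m X + card (leaving {m} X)"
proof -
  \<comment> \<open>For \<open>m = 1\<close> the complementing generator would coincide with
    \<open>{0}\<close> and be counted only once in the set of generators.\<close>
  have "{..<m} \<noteq> {i}" for i :: nat
  proof
    assume "{..<m} = {i}"
    then have "card {..<m} = 1" by simp
    then show False using assms by simp
  qed
  then have "{..<m} \<notin> (\<lambda>i. {i}) ` {..<Suc m}" by auto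
  then have "boundary_size (Suc m) X = card (leaving {..<m} X) + (\<Sum>g\<in>(\<lambda>i. {i}) ` {..<Suc m}. card (leaving g X))"
    unfolding boundary_size_def generators_def by simp
  also have "(\<Sum>g\<in>(\<lambda>i. {i}) ` {..<Suc m}. card (leaving g X)) = (\<Sum>i<Suc m. card (leaving {i} X))"
    by (subst sum.reindex) (auto simp: inj_on_def)
  finally show ?thesis unfolding folded_boundary_size_def by simp
qed

lemma card_leaving_split:
  assumes "finite S" "i \<notin> g"
  shows "card (leaving g S) = card (leaving g (lower i S)) + card (leaving g (upper i S))"
  using card_staying_split[OF assms] card_staying_leaving[OF assms(1), of g] card_split[OF assms(1), of i]
    card_staying_leaving[OF finite_lower[OF assms(1)], of g i] card_staying_leaving[OF finite_upper[OF assms(1)], of g i]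
  by linarith

lemma folded_boundary_size_split:
  assumes "finite X"
  shows "folded_boundary_size m X = folded_boundary_size m (lower m X) + folded_boundary_size m (upper m X)"
proof -
  have "(\<Sum>j<m. card (leaving {j} X)) = (\<Sum>j<m. card (leaving {j} (lower m X)) + card (leaving {j} (upper m X)))"
    by (rule sum.cong) (auto intro!: card_leaving_split assms)
  then show ?thesis
    unfolding folded_boundary_size_def using card_leaving_split[OF assms, of m "{..<m}"]
    by (simp add: sum.distrib)
qed

lemma folded_boundary_size_compl: "A \<subseteq> Pow {..<m} \<Longrightarrow> folded_boundary_size m (Pow {..<m} - A) = folded_boundary_size m A"
  unfolding folded_boundary_size_def
    by (intro arg_cong2[where f="(+)"] sum.cong card_leaving_compl) auto

section \<open>Lower bounds for boundaries\<close>

text \<open>The folded hypercube has \<open>m + 1\<close> generators, so boundary size and degree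
  sum add up to \<open>(m + 1) * card A\<close>.\<close>

lemma folded_boundary_size_ge:
  assumes "A \<subseteq> Pow {..<m}" "card A \<le> 2 ^ (m - 1)" "m \<ge> 1"
  shows "(m + 1) * card A \<le> folded_boundary_size m A + cube_degsum (card A)"
proof -
  have fA: "finite A" using assms finite_subset by blast
  have "(\<Sum>j<m. card (staying {j} A)) + (\<Sum>j<m. card (leaving {j} A)) = (\<Sum>j<m. card A)"
    unfolding sum.distrib[symmetric] using card_staying_leaving[OF fA] by simp
  then have "degsum {..<m} A + card (staying {..<m} A) + folded_boundary_size m A = (m + 1) * card A"
    unfolding degsum_def folded_boundary_size_def
      using card_staying_leaving[OF fA, of "{..<m}"] by simp
  then show ?thesis using folded_degsum_le[OF assms] by linarith
qed

text \<open>The matching edges leaving \<open>X\<close> correspond to the symmetric difference of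
  its two halves, whose size is at least the difference of their sizes.\<close>

lemma card_leaving_top:
  assumes "finite X"
  shows "card (lower m X) \<le> card (upper m X) + card (leaving {m} X)"
    "card (upper m X) \<le> card (lower m X) + card (leaving {m} X)"
proof -
  have f: "finite (lower m X)" "finite (upper m X)"
    using finite_lower[OF assms] finite_upper[OF assms] by auto
  have "card (lower m X \<inter> upper m X) \<le> card (lower m X)" "card (lower m X \<inter> upper m X) \<le> card (upper m X)"
    by (auto intro!: card_mono f)
  then show "card (lower m X) \<le> card (upper m X) + card (leaving {m} X)"
    "card (upper m X) \<le> card (lower m X) + card (leaving {m} X)"
    using card_staying_leaving[OF assms, of "{m}"] card_staying_singleton[OF assms, of m] card_split[OF assms, of m]
    by linarith+
qed

text \<open>Here \<open>(k + 4) * x - cube_degsum x\<close> is the boundary of an optimal set in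
  dimension \<open>k + 4\<close>. Above \<open>2 * 2 ^ k\<close> there are 2 boundary edges per
  vertex; above \<open>2 ^ k\<close>, splitting off a subcube of size \<open>2 ^ k\<close> leaves
  its \<open>4 * 2 ^ k\<close> plus a nonnegative rest; below, with \<open>r = 2 ^ k - x\<close>
  missing vertices, the boundary is \<open>4 * x + (k * r - cube_degsum r)\<close>, at least
  \<open>4 * (x + r)\<close>.\<close>

lemma cube_boundary_ge:
  assumes "11 * 2 ^ k \<le> 12 * x" "x \<le> 4 * 2 ^ k"
  shows "4 * 2 ^ k + cube_degsum x \<le> (k + 4) * x"
proof -
  consider "2 * 2 ^ k \<le> x" | "2 ^ k \<le> x" "x \<le> 2 * 2 ^ k" | "x \<le> 2 ^ k" by linarith
  then show ?thesis
  proof cases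
    case 1
    then show ?thesis using cube_degsum_le[of x "k + 2"] assms by (simp add: algebra_simps)
  next
    case 2
    define s where "s = x - 2 ^ k"
    have s: "x = 2 ^ k + s" "s \<le> 2 ^ k" using 2 unfolding s_def by auto
    show ?thesis unfolding s(1) cube_degsum_power2_add[OF s(2)] using cube_degsum_le[OF s(2)]
      by (simp add: algebra_simps)
  next
    case 3
    define r where "r = 2 ^ k - x"
    have r: "12 * r \<le> 2 ^ k" "2 ^ k - x = r" "int x = 2 ^ k - int r"
      using 3 assms unfolding r_def by (auto simp: of_nat_diff)
    have "2 * int x - 2 ^ k = int x - int r" using r(3) by simp
    then have "int (cube_degsum x) = int (cube_degsum r) + int k * (int x - int r)"
      using cube_degsum_power2_diff[OF 3] unfolding r(2) by argo
    then have "int (cube_degsum x) = int (cube_degsum r) + (int k * int x - int k * int r)"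
      by (simp only: right_diff_distrib)
    moreover have "int (cube_degsum r) + 4 * int r \<le> int k * int r"
      using cube_degsum_le_codim4[OF r(1)]
        by (metis of_nat_add of_nat_le_iff of_nat_mult of_nat_numeral)
    ultimately have "4 * 2 ^ k + int (cube_degsum x) \<le> int k * int x + 4 * int x"
      using r(3) by linarith
    then have "int (4 * 2 ^ k + cube_degsum x) \<le> int ((k + 4) * x)"
      by (simp add: distrib_right)
    then show ?thesis by (subst (asm) of_nat_le_iff)
  qed
qed

text \<open>The difference \<open>card A - card B\<close>, written additively, stands for the
  matching edges. If \<open>A\<close> fills at most half of its copy, superadditivity contributes
  \<open>2 * card B\<close>, which together with this difference raises the degree from
  \<open>k + 3\<close> to \<open>k + 4\<close>. Otherwise the complement \<open>?C\<close> of
  \<open>A\<close> has boundary at least \<open>2 * card ?C\<close>, and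
  \<open>2 * card ?C + card A \<ge> 4 * 2 ^ k\<close>.\<close>

lemma folded_boundary_size_pair_ge:
  assumes A: "A \<subseteq> Pow {..<k + 2}" and B: "B \<subseteq> Pow {..<k + 2}" and ba: "card B \<le> card A"
    and lo: "11 * 2 ^ k \<le> 12 * (card A + card B)" and hi: "card A + card B \<le> 4 * 2 ^ k"
  shows "4 * 2 ^ k + card B \<le> folded_boundary_size (k + 2) A + folded_boundary_size (k + 2) B + card A"
proof -
  have p: "2 ^ (k + 2 - 1) = 2 * (2::nat) ^ k" by simp
  have B': "(k + 3) * card B \<le> folded_boundary_size (k + 2) B + cube_degsum (card B)"
    using folded_boundary_size_ge[OF B] ba hi by (simp add: algebra_simps)
  show ?thesis
  proof (cases "card A \<le> 2 * 2 ^ k")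
    case True
    have "(k + 3) * card A \<le> folded_boundary_size (k + 2) A + cube_degsum (card A)"
      using folded_boundary_size_ge[OF A] True by (simp add: algebra_simps)
    moreover have "4 * 2 ^ k + cube_degsum (card A + card B) \<le> (k + 4) * (card A + card B)"
      by (rule cube_boundary_ge[OF lo hi])
    moreover have "cube_degsum (card A) + cube_degsum (card B) + 2 * card B \<le> cube_degsum (card A + card B)"
      using cube_degsum_superadd[of "card A" "card B"] ba by simp
    ultimately show ?thesis using B' by (simp add: algebra_simps)
  next
    case False
    let ?C = "Pow {..<k + 2} - A"
    have fA: "finite A" using A finite_subset by blast
    have c: "card ?C + card A = 4 * 2 ^ k"
      using card_Diff_subset[OF fA A] card_mono[OF _ A] by (simp add: card_Pow)
    then have c2: "card ?C \<le> 2 ^ (k + 1)" using False by simp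
    have b2: "card B \<le> 2 ^ (k + 1)" using False hi by simp
    have "(k + 3) * card ?C \<le> folded_boundary_size (k + 2) ?C + cube_degsum (card ?C)"
      using folded_boundary_size_ge[of ?C "k + 2"] c2 by (simp add: algebra_simps)
    then have "2 * card ?C \<le> folded_boundary_size (k + 2) A"
      unfolding folded_boundary_size_compl[OF A]
        using cube_degsum_le[OF c2] by (simp add: algebra_simps)
    moreover have "2 * card B \<le> folded_boundary_size (k + 2) B"
      using B' cube_degsum_le[OF b2] by (simp add: algebra_simps)
    ultimately show ?thesis using c hi by linarith
  qed
qed

text \<open>For \<open>n = k + 3\<close> the bound \<open>4 * 2 ^ k\<close> is
  \<open>2 ^ (n - 1)\<close>, and the lower bound on \<open>card X\<close> is
  \<open>11 * 2 ^ (n - 1) / 48\<close>. The larger of the two halves takes the role of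
  \<open>A\<close> in the preceding lemma.\<close>

lemma boundary_size_ge:
  assumes X: "X \<subseteq> Pow {..<k + 3}" and lo: "11 * 2 ^ k \<le> 12 * card X" and hi: "card X \<le> 4 * 2 ^ k"
  shows "4 * 2 ^ k \<le> boundary_size (k + 3) X"
proof -
  let ?m = "k + 2"
  have fX: "finite X" using X finite_subset by blast
  have e: "{..<k + 3} - {?m} = {..<?m}" by auto
  have A: "lower ?m X \<subseteq> Pow {..<?m}" and B: "upper ?m X \<subseteq> Pow {..<?m}"
    using lower_Pow[OF X, of ?m] upper_Pow[OF X, of ?m] unfolding e by auto
  have c: "card X = card (lower ?m X) + card (upper ?m X)" by (rule card_split[OF fX])
  have b: "boundary_size (k + 3) X = folded_boundary_size ?m (lower ?m X) + folded_boundary_size ?m (upper ?m X) + card (leaving {?m} X)"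
    using boundary_size_eq[of ?m X] folded_boundary_size_split[OF fX, of ?m]
      by (simp add: numeral_3_eq_3)
  show ?thesis
  proof (cases "card (upper ?m X) \<le> card (lower ?m X)")
    case True
    then show ?thesis
      using folded_boundary_size_pair_ge[OF A B True] lo hi card_leaving_top(1)[OF fX, of ?m]
        unfolding b c
      by linarith
  next
    case False
    then have "card (lower ?m X) \<le> card (upper ?m X)" by simp
    then show ?thesis
      using folded_boundary_size_pair_ge[OF B A] lo hi card_leaving_top(2)[OF fX, of ?m]
        unfolding b c
      by (simp add: add.commute)
  qed
qed

section \<open>Sets with small boundary\<close>

lemma leaving_unused: "S \<subseteq> Pow L \<Longrightarrow> i \<notin> L \<Longrightarrow> leaving {i} S = S"
  unfolding leaving_def flip_def by auto

lemma leaving_Pow: "g \<subseteq> L \<Longrightarrow> leaving g (Pow L) = {}"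
  by (simp add: leaving_def flip_Pow)

text \<open>
  The size is the least \<open>q\<close> with \<open>12 * q > 2 ^ (j + 4)\<close>. It exceeds the size for \<open>j - 2\<close>
  by \<open>2 ^ j\<close>, so a family is built by attaching the one for \<open>j - 2\<close> to a subcube.
\<close>

lemma small_boundary_family:
  "\<exists>Y. Y \<subseteq> Pow {..<Suc j} \<and> (\<forall>x\<in>Y. \<forall>i\<in>x. x - {i} \<in> Y) \<and> card Y = 2 ^ (j + 4) div 12 + 1 \<and>
     (\<Sum>l<j + 4. card (leaving {l} Y)) < 4 * card Y"
proof (induction j rule: nat_induct2)
  case 0
  let ?Y = "Pow {..<Suc 0}"
  have "card (leaving {l} ?Y) = (if l = 0 then 0 else 2)" for l
    using leaving_Pow[of "{l}" "{..<Suc 0}"] leaving_unused[of ?Y "{..<Suc 0}" l]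
      by (simp add: card_Pow)
  then have "(\<Sum>l<0 + 4. card (leaving {l} ?Y)) < 4 * card ?Y"
    by (simp add: numeral_eq_Suc card_Pow)
  moreover have "card ?Y = 2 ^ (0 + 4) div 12 + 1" by (simp add: card_Pow)
  ultimately show ?case by (intro exI[of _ ?Y]) auto
next
  case 1
  let ?Y = "{{}, {0::nat}, {1}}"
  have cY: "card ?Y = 3" by simp
  have f: "flip {a} {} = {a}" "flip {a} {a} = {}" for a :: nat by (simp_all add: flip_def)
  have le3: "card (leaving {l} ?Y) \<le> 3" for l
    using card_staying_leaving[of ?Y "{l}"] cY by simp
  have "leaving {0} ?Y \<subseteq> {{1}}"
    unfolding leaving_def
      using f[of 0] by (intro subsetI) (metis (mono_tags) insert_iff mem_Collect_eq)
  moreover have "leaving {1} ?Y \<subseteq> {{0}}"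
    unfolding leaving_def
      using f[of 1] by (intro subsetI) (metis (mono_tags) insert_iff mem_Collect_eq)
  ultimately have "card (leaving {0} ?Y) \<le> 1" "card (leaving {1} ?Y) \<le> 1"
    using card_mono[of "{{1}}" "leaving {0} ?Y"] card_mono[of "{{0}}" "leaving {1} ?Y"] by simp_all
  then have "(\<Sum>l<5. card (leaving {l} ?Y)) < 4 * card ?Y"
    using le3[of 2] le3[of 3] le3[of 4] cY by (simp add: numeral_eq_Suc)
  moreover have "?Y \<subseteq> Pow {..<Suc 1}" by auto
  moreover have "\<forall>x\<in>?Y. \<forall>i\<in>x. x - {i} \<in> ?Y" by simp
  ultimately show ?case using cY by (intro exI[of _ ?Y]) simp
next
  case (step j)
  then obtain Y where Y: "Y \<subseteq> Pow {..<Suc j}" and down: "\<And>x i. x \<in> Y \<Longrightarrow> i \<in> x \<Longrightarrow> x - {i} \<in> Y"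
    and c: "card Y = 2 ^ (j + 4) div 12 + 1" and b: "(\<Sum>l<j + 4. card (leaving {l} Y)) < 4 * card Y"
    by blast
  let ?P = "Pow {..<j + 2}"
  let ?Z = "?P \<union> insert (j + 2) ` Y"
  have YP: "Y \<subseteq> ?P" using Y by fastforce
  have fY: "finite Y" using Y finite_subset by blast
  have fZ: "finite ?Z" using fY by simp
  have low: "lower (j + 2) ?Z = ?P" unfolding lower_def by auto
  have up: "upper (j + 2) ?Z = Y"
  proof (intro set_eqI iffI)
    fix x assume "x \<in> upper (j + 2) ?Z"
    then obtain y where y: "j + 2 \<notin> x" "insert (j + 2) x = insert (j + 2) y" "y \<in> Y"
      unfolding upper_def by auto
    moreover have "j + 2 \<notin> y" using y(3) YP by auto
    ultimately have "x = y" using insert_ident by metis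
    then show "x \<in> Y" using y by simp
  qed (use YP in \<open>auto simp: upper_def\<close>)
  have cZ: "card ?Z = 4 * 2 ^ j + card Y"
    using card_split[OF fZ, of "j + 2"] unfolding low up by (simp add: card_Pow)
  have sp: "card (leaving {l} ?Z) = card (leaving {l} ?P) + card (leaving {l} Y)"
    if "l \<noteq> j + 2" for l
    using card_leaving_split[OF fZ, of "j + 2" "{l}"] that unfolding low up by simp
  have in_l: "card (leaving {l} ?Z) = card (leaving {l} Y)" if "l < j + 2" for l
    using sp[of l] leaving_Pow[of "{l}" "{..<j + 2}"] that by simp
  have leaving_l: "card (leaving {l} ?Z) = 4 * 2 ^ j + card Y" if "l > j + 2" for l
    using sp[of l] leaving_unused[of ?P "{..<j + 2}" l] leaving_unused[OF YP, of l] that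
      by (simp add: card_Pow)
  have mid: "card (leaving {j + 2} ?Z) + card Y = 4 * 2 ^ j"
  proof -
    have "card (staying {j + 2} ?Z) = 2 * card Y"
      unfolding card_staying_singleton[OF fZ] low up using YP by (simp add: Int_absorb1)
    then show ?thesis using card_staying_leaving[OF fZ, of "{j + 2}"] cZ by linarith
  qed
  have bY: "(\<Sum>l<j + 4. card (leaving {l} Y)) = (\<Sum>l<j + 2. card (leaving {l} Y)) + 2 * card Y"
    using leaving_unused[OF YP, of "j + 2"] leaving_unused[OF YP, of "j + 3"]
      by (simp add: numeral_eq_Suc)
  have "(\<Sum>l<j + 6. card (leaving {l} ?Z)) = (\<Sum>l<j + 2. card (leaving {l} ?Z)) + card (leaving {j + 2} ?Z)
      + card (leaving {j + 3} ?Z) + card (leaving {j + 4} ?Z) + card (leaving {j + 5} ?Z)"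
    by (simp add: numeral_eq_Suc)
  \<comment> \<open>The directions below \<open>j + 2\<close> give less than
    \<open>2 * card Y\<close>, direction \<open>j + 2\<close> gives
    \<open>4 * 2 ^ j - card Y\<close>, and each of the remaining three gives
    \<open>card ?Z\<close>.\<close>
  also have "\<dots> < 4 * card ?Z"
    using in_l leaving_l[of "j + 3"] leaving_l[of "j + 4"] leaving_l[of "j + 5"] mid bY b cZ by simp
  finally have bZ: "(\<Sum>l<j + 2 + 4. card (leaving {l} ?Z)) < 4 * card ?Z"
    by (simp add: add.commute)
  have "?Z \<subseteq> Pow {..<Suc (j + 2)}" using YP by fastforce
  moreover have "x - {i} \<in> ?Z" if x: "x \<in> ?Z" "i \<in> x" for x i
  proof (cases "x \<in> ?P")
    case False
    then obtain y where y: "x = insert (j + 2) y" "y \<in> Y" using x by auto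
    have ny: "j + 2 \<notin> y" using y YP by auto
    show ?thesis
    proof (cases "i = j + 2")
      case True
      then show ?thesis using y YP ny by auto
    next
      case False
      then have "x - {i} = insert (j + 2) (y - {i})" "i \<in> y" using y x by auto
      then show ?thesis using down[OF y(2)] by auto
    qed
  qed auto
  moreover have "card ?Z = 2 ^ (j + 2 + 4) div 12 + 1"
    unfolding cZ c by (simp add: power_add)
  ultimately show ?case using bZ by (intro exI[of _ ?Z] conjI ballI) assumption+
qed

section \<open>Families connected by adding elements\<close>

text \<open>A sufficient condition for connectedness: adding elements one at a time within
  \<open>X\<close> leads from every member to \<open>u\<close>.\<close>

definition raisable :: "nat \<Rightarrow> nat set set \<Rightarrow> bool" where
  "raisable n X \<longleftrightarrow> (\<exists>u\<in>X. \<forall>x\<in>X. x \<noteq> u \<longrightarrow> (\<exists>i<n. i \<notin> x \<and> insert i x \<in> X))"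

lemma raisable_Pow: "k \<le> n \<Longrightarrow> raisable n (Pow {..<k})"
proof -
  assume k: "k \<le> n"
  have "\<exists>i<n. i \<notin> x \<and> insert i x \<in> Pow {..<k}"
    if x: "x \<subseteq> {..<k}" "x \<noteq> {..<k}" for x
  proof -
    obtain i where "i < k" "i \<notin> x" using x by auto
    then show ?thesis using x k by (intro exI[of _ i]) auto
  qed
  then show ?thesis unfolding raisable_def by (intro bexI[of _ "{..<k}"]) auto
qed

text \<open>Adding \<open>k\<close> leads out of the subcube \<open>Pow {..<k}\<close>; from there
  any further element may be added, up to \<open>{..<n}\<close>.\<close>

lemma raisable_compl:
  assumes Y: "Y \<subseteq> Pow {..<k}" and kn: "k < n"
  shows "raisable n (Pow {..<n} - (Pow {..<k} - Y))"
  unfolding raisable_def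
proof (intro bexI[of _ "{..<n}"] ballI impI)
  let ?Z = "Pow {..<n} - (Pow {..<k} - Y)"
  show "{..<n} \<in> ?Z" using kn by auto
  fix x assume x: "x \<in> ?Z" "x \<noteq> {..<n}"
  show "\<exists>i<n. i \<notin> x \<and> insert i x \<in> ?Z"
  proof (cases "x \<subseteq> {..<k}")
    case True
    then show ?thesis using kn x by (intro exI[of _ k]) auto
  next
    case False
    obtain i where "i < n" "i \<notin> x" using x by auto
    then show ?thesis using False x by (intro exI[of _ i]) auto
  qed
qed

text \<open>\<open>X\<close> is the subcube \<open>Pow {..<k}\<close> without a family
  \<open>Y\<close> of small boundary. The directions below \<open>k\<close> give the boundary of
  \<open>Y\<close>, less than \<open>4 * card Y\<close>, and each of the other four generators at
  most \<open>card X\<close>. As \<open>Y\<close> is closed under removing elements,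
  \<open>X\<close> is closed under adding elements below \<open>k\<close>.\<close>

lemma exists_small_boundary:
  assumes "k \<ge> 4"
  shows "\<exists>X \<subseteq> Pow {..<k}. card X + (2 ^ k div 12 + 1) = 2 ^ k \<and> boundary_size (k + 3) X < 4 * 2 ^ k \<and>
     raisable (k + 3) X \<and> raisable (k + 3) (Pow {..<k + 3} - X)"
proof -
  obtain j where j: "k = j + 4" using assms by (metis le_add_diff_inverse2)
  obtain Y where Y: "Y \<subseteq> Pow {..<Suc j}" and down: "\<And>x i. x \<in> Y \<Longrightarrow> i \<in> x \<Longrightarrow> x - {i} \<in> Y"
    and c: "card Y = 2 ^ k div 12 + 1" and b: "(\<Sum>l<k. card (leaving {l} Y)) < 4 * card Y"
    using small_boundary_family[of j] unfolding j by blast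
  let ?X = "Pow {..<k} - Y"
  have YP: "Y \<subseteq> Pow {..<k}" using Y unfolding j by fastforce
  have fY: "finite Y" using Y finite_subset by blast
  have fX: "finite ?X" by simp
  have cX: "card ?X + card Y = 2 ^ k"
    using card_Diff_subset[OF fY YP] card_mono[OF _ YP] by (simp add: card_Pow)
  have "(\<Sum>l<k. card (leaving {l} ?X)) = (\<Sum>l<k. card (leaving {l} Y))"
    by (rule sum.cong) (auto intro!: card_leaving_compl[OF YP])
  moreover have "(\<Sum>l<k + 2. card (leaving {l} ?X)) = (\<Sum>l<k. card (leaving {l} ?X)) + 2 * card ?X"
    using leaving_unused[of ?X "{..<k}" k] leaving_unused[of ?X "{..<k}" "Suc k"]
      by (simp add: numeral_eq_Suc)
  moreover have o: "card (leaving g ?X) \<le> card ?X" for g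
    using card_staying_leaving[OF fX, of g] by linarith
  moreover have "boundary_size (k + 3) ?X = card (leaving {..<k + 2} ?X) + (\<Sum>l<k + 2. card (leaving {l} ?X)) + card (leaving {k + 2} ?X)"
    using boundary_size_eq[of "k + 2" ?X] by (simp add: folded_boundary_size_def numeral_3_eq_3)
  ultimately have "boundary_size (k + 3) ?X < 4 * card ?X + 4 * card Y"
    using b o[of "{..<k + 2}"] o[of "{k + 2}"] by linarith
  then have bX: "boundary_size (k + 3) ?X < 4 * 2 ^ k" using cX by simp
  have "{..<k} \<notin> Y" using Y j by fastforce
  moreover have "\<exists>i<k + 3. i \<notin> x \<and> insert i x \<in> ?X"
    if x: "x \<in> ?X" "x \<noteq> {..<k}" for x
  proof -
    obtain i where i: "i < k" "i \<notin> x" using x by auto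
    have "insert i x \<notin> Y" using down[of "insert i x" i] i x by auto
    then show ?thesis using i x by (intro exI[of _ i]) auto
  qed
  ultimately have "raisable (k + 3) ?X"
    unfolding raisable_def by (intro bexI[of _ "{..<k}"]) auto
  moreover have "raisable (k + 3) (Pow {..<k + 3} - ?X)"
    by (rule raisable_compl[OF YP]) simp
  ultimately show ?thesis using bX cX c by (intro exI[of _ ?X]) auto
qed

text \<open>The set is one copy of the folded hypercube, which only the matching edges
  leave.\<close>

lemma boundary_size_half: "m \<ge> 2 \<Longrightarrow> boundary_size (Suc m) (Pow {..<m}) = 2 ^ m"
  using leaving_unused[of "Pow {..<m}" "{..<m}" m]
    by (simp add: boundary_size_eq folded_boundary_size_def leaving_Pow card_Pow)

section \<open>Extra edge-cuts and edge boundaries\<close>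

definition edge_boundary :: "'a ugraph \<Rightarrow> 'a set \<Rightarrow> 'a set set" where
  "edge_boundary G X = {e \<in> edges G. \<exists>x\<in>X. \<exists>y\<in>vertices G - X. e = {x, y}}"

lemma connectivity_rel_sym: "(u, v) \<in> connectivity_rel G \<Longrightarrow> (v, u) \<in> connectivity_rel G"
proof -
  have "sym ({(x, y). {x, y} \<in> edges G}\<^sup>*)"
    by (rule sym_rtrancl) (auto simp: sym_def insert_commute)
  then show "(u, v) \<in> connectivity_rel G \<Longrightarrow> (v, u) \<in> connectivity_rel G"
    unfolding connectivity_rel_def by (auto dest: symD)
qed

lemma connectivity_rel_trans:
  "(u, v) \<in> connectivity_rel G \<Longrightarrow> (v, w) \<in> connectivity_rel G \<Longrightarrow> (u, w) \<in> connectivity_rel G"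
  unfolding connectivity_rel_def by auto

lemma components_iff: "C \<in> components G \<longleftrightarrow> (\<exists>v\<in>vertices G. C = connectivity_rel G `` {v})"
  unfolding components_def quotient_def by auto

lemma component_subset: "C \<in> components G \<Longrightarrow> C \<subseteq> vertices G"
  unfolding components_iff connectivity_rel_def by auto

text \<open>There are two disjoint components, and the smaller has at most half of the
  vertices.\<close>

lemma exists_small_component:
  assumes "finite (vertices G)" "vertices G \<noteq> {}" "\<not> connected_graph G"
  shows "\<exists>C\<in>components G. 2 * card C \<le> card (vertices G)"
proof -
  obtain u v where uv: "u \<in> vertices G" "v \<in> vertices G" "(u, v) \<notin> connectivity_rel G"
    using assms unfolding connected_graph_def by auto
  let ?C = "connectivity_rel G `` {u}" and ?D = "connectivity_rel G `` {v}"
  have C: "?C \<in> components G" "?D \<in> components G" using uv unfolding components_iff by auto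
  have "?C \<inter> ?D = {}" using uv(3) connectivity_rel_sym connectivity_rel_trans by fastforce
  moreover have sub: "?C \<subseteq> vertices G" "?D \<subseteq> vertices G"
    using C component_subset by blast+
  ultimately have "card ?C + card ?D \<le> card (vertices G)"
    using assms(1) by (metis Un_least card_Un_disjoint card_mono finite_subset)
  then have "2 * card ?C \<le> card (vertices G) \<or> 2 * card ?D \<le> card (vertices G)"
    by linarith
  then show ?thesis using C by blast
qed

text \<open>An edge leaving a component must have been deleted. Lower bounds on boundaries thus
  become lower bounds on cuts.\<close>

lemma edge_boundary_component:
  assumes "C \<in> components (delete_edges G F)"
  shows "edge_boundary G C \<subseteq> F"
proof
  fix e assume "e \<in> edge_boundary G C"
  then obtain x y where e: "e \<in> edges G" "e = {x, y}" "x \<in> C" "y \<in> vertices G" "y \<notin> C"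
    unfolding edge_boundary_def by auto
  let ?H = "delete_edges G F"
  obtain v where v: "C = connectivity_rel ?H `` {v}" using assms unfolding components_iff by auto
  have x: "x \<in> vertices ?H" using component_subset[OF assms] e(3) by auto
  show "e \<in> F"
  proof (rule ccontr)
    assume "e \<notin> F"
    then have "{x, y} \<in> edges ?H" using e unfolding delete_edges_def by simp
    then have "(x, y) \<in> connectivity_rel ?H"
      using x e(4) unfolding connectivity_rel_def by (auto simp: delete_edges_def)
    then show False using e v connectivity_rel_trans[of v x ?H y] by auto
  qed
qed

text \<open>Both \<open>X\<close> and its complement induce connected subgraphs by
  \<open>con\<close>, so every component after the deletion contains one of them.\<close>

lemma extra_edge_cut_edge_boundary:
  assumes V: "finite (vertices G)" and wf: "\<And>e. e \<in> edges G \<Longrightarrow> e \<subseteq> vertices G"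
    and X: "X \<subseteq> vertices G" "X \<noteq> {}" "vertices G - X \<noteq> {}"
    and con: "\<And>Z x y. Z = X \<or> Z = vertices G - X \<Longrightarrow> x \<in> Z \<Longrightarrow> y \<in> Z \<Longrightarrow>
       (x, y) \<in> {(a, b). a \<in> Z \<and> b \<in> Z \<and> {a, b} \<in> edges G}\<^sup>*"
    and h: "h \<le> card X" "h \<le> card (vertices G - X)"
  shows "extra_edge_cut h G (edge_boundary G X)"
proof -
  let ?F = "edge_boundary G X"
  let ?H = "delete_edges G ?F"
  have VH: "vertices ?H = vertices G" unfolding delete_edges_def by simp
  have stay: "y \<in> X" if "(x, y) \<in> {(x, y). {x, y} \<in> edges ?H}\<^sup>*" "x \<in> X"
    for x y
    using that
  proof (induction rule: rtrancl_induct)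
    case (step y z)
    then have yz: "{y, z} \<in> edges G" "{y, z} \<notin> ?F" "y \<in> X"
      unfolding delete_edges_def by auto
    then have "z \<in> vertices G" using wf by auto
    then show ?case using yz unfolding edge_boundary_def by auto
  qed
  obtain u v where "u \<in> X" "v \<in> vertices G - X" using X by auto
  then have "(u, v) \<notin> connectivity_rel ?H" using stay unfolding connectivity_rel_def by blast
  then have nc: "\<not> connected_graph ?H"
    using \<open>u \<in> X\<close> \<open>v \<in> vertices G - X\<close> X
      unfolding connected_graph_def VH by blast
  have link: "(x, y) \<in> connectivity_rel ?H"
    if Z: "Z = X \<or> Z = vertices G - X" and xy: "x \<in> Z" "y \<in> Z" for Z x y
  proof -
    have "{(a, b). a \<in> Z \<and> b \<in> Z \<and> {a, b} \<in> edges G} \<subseteq> {(x, y). {x, y} \<in> edges ?H}"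
      using Z unfolding delete_edges_def edge_boundary_def by (auto simp: doubleton_eq_iff)
    then have "(x, y) \<in> {(x, y). {x, y} \<in> edges ?H}\<^sup>*"
      using con[OF Z xy] rtrancl_mono by blast
    then show ?thesis using Z xy X unfolding connectivity_rel_def VH by auto
  qed
  have "h \<le> card C" if C: "C \<in> components ?H" for C
  proof -
    obtain v where v: "v \<in> vertices G" "C = connectivity_rel ?H `` {v}"
      using C unfolding components_iff VH by auto
    obtain Z where Z: "Z = X \<or> Z = vertices G - X" "v \<in> Z" using v by auto
    have "Z \<subseteq> C" using link[OF Z(1) Z(2)] v by auto
    moreover have "finite C" using component_subset[OF C] V finite_subset VH by metis
    ultimately have "card Z \<le> card C" by (rule card_mono[rotated])
    then show ?thesis using Z h by auto
  qed
  then show ?thesis using nc unfolding extra_edge_cut_def edge_boundary_def by auto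
qed

section \<open>Binary strings and sets\<close>

text \<open>The index is reversed because the head of the list is the top bit: it records membership
  of \<open>n - 1\<close>, and the tail that of the elements below.\<close>

definition string_of_set :: "nat \<Rightarrow> nat set \<Rightarrow> bool list" where
  "string_of_set n s = map (\<lambda>i. n - 1 - i \<in> s) [0..<n]"

lemma length_string_of_set [simp]: "length (string_of_set n s) = n"
  unfolding string_of_set_def by simp

lemma nth_string_of_set [simp]: "i < n \<Longrightarrow> string_of_set n s ! i \<longleftrightarrow> n - 1 - i \<in> s"
  unfolding string_of_set_def by simp

lemma inj_on_string_of_set: "inj_on (string_of_set n) (Pow {..<n})"
proof (rule inj_onI)
  fix s t assume st: "s \<in> Pow {..<n}" "t \<in> Pow {..<n}" "string_of_set n s = string_of_set n t"
  have "j \<in> s \<longleftrightarrow> j \<in> t" if "j < n" for j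
    using nth_string_of_set[of "n - 1 - j" n s] nth_string_of_set[of "n - 1 - j" n t] st(3) that
      by simp
  then show "s = t" using st(1,2) by blast
qed

lemma string_of_set_image: "string_of_set n ` Pow {..<n} = binary_strings n"
proof (intro set_eqI iffI)
  fix x :: "bool list" assume "x \<in> binary_strings n"
  then have x: "length x = n" unfolding binary_strings_def by simp
  let ?s = "{j. j < n \<and> x ! (n - 1 - j)}"
  have "string_of_set n ?s = x"
  proof (rule nth_equalityI)
    fix i assume "i < length (string_of_set n ?s)"
    then have "i < n" by simp
    then show "string_of_set n ?s ! i = x ! i" by simp
  qed (simp add: x)
  then show "x \<in> string_of_set n ` Pow {..<n}" by (intro image_eqI[of _ _ ?s]) auto
qed (auto simp: binary_strings_def)

lemma flip_eq_iff: "flip x y = g \<longleftrightarrow> y = flip g x"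
  unfolding flip_def by auto

lemma string_of_set_flip_tail:
  assumes "n \<ge> 1"
  shows "hd (string_of_set n x) # map Not (tl (string_of_set n x)) = string_of_set n (flip {..<n - 1} x)"
proof (rule nth_equalityI)
  show "length (hd (string_of_set n x) # map Not (tl (string_of_set n x))) = length (string_of_set n (flip {..<n - 1} x))"
    using assms by simp
  fix i assume "i < length (hd (string_of_set n x) # map Not (tl (string_of_set n x)))"
  then have i: "i < n" using assms by simp
  have ne: "string_of_set n x \<noteq> []"
    using assms by (metis length_string_of_set length_0_conv not_one_le_zero)
  show "(hd (string_of_set n x) # map Not (tl (string_of_set n x))) ! i = string_of_set n (flip {..<n - 1} x) ! i"
  proof (cases i)
    case 0
    then show ?thesis using assms ne by (simp add: hd_conv_nth flip_def)
  next
    case (Suc l)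
    then have l: "l < n - 1" "Suc l < n" using i by auto
    have "tl (string_of_set n x) ! l = string_of_set n x ! Suc l" using l by (simp add: nth_tl)
    then show ?thesis using Suc l i by (auto simp: flip_def)
  qed
qed

text \<open>Reversing indices maps the symmetric difference \<open>flip x y\<close> bijectively to
  the positions where the strings differ.\<close>

lemma adj_string_of_set:
  assumes x: "x \<subseteq> {..<n}" and y: "y \<subseteq> {..<n}" and n: "n \<ge> 1"
  shows "enhanced_hypercube_adj n (string_of_set n x) (string_of_set n y) \<longleftrightarrow> (\<exists>g\<in>generators n. y = flip g x)"
proof -
  have fl: "flip x y \<subseteq> {..<n}" using flip_Pow[OF y x] .
  have "{i. i < n \<and> string_of_set n x ! i \<noteq> string_of_set n y ! i} = (\<lambda>j. n - 1 - j) ` flip x y"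
  proof (intro set_eqI iffI)
    fix i assume "i \<in> {i. i < n \<and> string_of_set n x ! i \<noteq> string_of_set n y ! i}"
    then have "n - 1 - i \<in> flip x y" "i = n - 1 - (n - 1 - i)" unfolding flip_def by auto
    then show "i \<in> (\<lambda>j. n - 1 - j) ` flip x y" by blast
  next
    fix i assume "i \<in> (\<lambda>j. n - 1 - j) ` flip x y"
    then obtain j where j: "j \<in> flip x y" "i = n - 1 - j" by auto
    then have "j < n" using fl by auto
    then have "i < n" "n - 1 - i = j" using j by auto
    then show "i \<in> {i. i < n \<and> string_of_set n x ! i \<noteq> string_of_set n y ! i}"
      using j(1) by (auto simp: flip_def)
  qed
  moreover have "inj_on (\<lambda>j. n - 1 - j) (flip x y)"
  proof (rule inj_onI)
    fix a b assume "a \<in> flip x y" "b \<in> flip x y" "n - 1 - a = n - 1 - b"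
    moreover then have "a < n" "b < n" using fl by auto
    ultimately show "a = b" by linarith
  qed
  ultimately have "card {i. i < n \<and> string_of_set n x ! i \<noteq> string_of_set n y ! i} = card (flip x y)"
    by (simp add: card_image)
  then have "card {i. i < n \<and> string_of_set n x ! i \<noteq> string_of_set n y ! i} = 1 \<longleftrightarrow> (\<exists>j. flip x y = {j})"
    by (simp add: card_1_singleton_iff)
  also have "\<dots> \<longleftrightarrow> (\<exists>j<n. y = flip {j} x)"
    using fl flip_eq_iff[of x y] by auto
  finally have 1: "card {i. i < n \<and> string_of_set n x ! i \<noteq> string_of_set n y ! i} = 1 \<longleftrightarrow> (\<exists>j<n. y = flip {j} x)" .
  have "flip {..<n - 1} x \<subseteq> {..<n}" using flip_Pow[OF x, of "{..<n - 1}"] by auto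
  then have 2: "string_of_set n y = hd (string_of_set n x) # map Not (tl (string_of_set n x)) \<longleftrightarrow> y = flip {..<n - 1} x"
    unfolding string_of_set_flip_tail[OF n]
      using inj_on_string_of_set[of n] y by (auto simp: inj_on_def)
  show ?thesis unfolding enhanced_hypercube_adj_def 1 2 generators_def by auto
qed

lemma generators_subset: "g \<in> generators n \<Longrightarrow> g \<subseteq> {..<n}"
  unfolding generators_def by auto

lemma finite_generators: "finite (generators n)"
  unfolding generators_def by simp

lemma vertices_enhanced_hypercube: "vertices (enhanced_hypercube n) = string_of_set n ` Pow {..<n}"
  unfolding enhanced_hypercube_def string_of_set_image by simp

lemma edges_enhanced_hypercube:
  assumes "n \<ge> 1"
  shows "edges (enhanced_hypercube n) = {{string_of_set n x, string_of_set n (flip g x)} | x g. x \<subseteq> {..<n} \<and> g \<in> generators n}"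
    (is "_ = ?R")
proof (intro set_eqI iffI)
  fix e assume "e \<in> edges (enhanced_hypercube n)"
  then obtain x y where "x \<subseteq> {..<n}" "y \<subseteq> {..<n}" "e = {string_of_set n x, string_of_set n y}"
    "enhanced_hypercube_adj n (string_of_set n x) (string_of_set n y)"
    unfolding enhanced_hypercube_def string_of_set_image[symmetric] by auto
  then show "e \<in> ?R" using adj_string_of_set[of x n y] assms by blast
next
  fix e assume "e \<in> ?R"
  then obtain x g where x: "x \<subseteq> {..<n}" "g \<in> generators n" "e = {string_of_set n x, string_of_set n (flip g x)}" by auto
  have f: "flip g x \<subseteq> {..<n}" using flip_Pow[OF x(1) generators_subset[OF x(2)]] .
  then have "enhanced_hypercube_adj n (string_of_set n x) (string_of_set n (flip g x))"
    using adj_string_of_set[OF x(1) f assms] x(2) by auto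
  then show "e \<in> edges (enhanced_hypercube n)"
    using x f unfolding enhanced_hypercube_def string_of_set_image[symmetric] by auto
qed

lemma string_of_set_mem_iff: "X \<subseteq> Pow {..<n} \<Longrightarrow> x \<subseteq> {..<n} \<Longrightarrow> string_of_set n x \<in> string_of_set n ` X \<longleftrightarrow> x \<in> X"
  using inj_on_image_mem_iff[OF inj_on_string_of_set] by blast

text \<open>A boundary edge determines its endpoint \<open>x\<close> in \<open>X\<close>, and then
  its generator as the symmetric difference of the endpoints, so boundary edges correspond to pairs
  of a generator \<open>g\<close> and a member of \<open>leaving g X\<close>.\<close>

lemma card_edge_boundary:
  assumes X: "X \<subseteq> Pow {..<n}" and n: "n \<ge> 1"
  shows "card (edge_boundary (enhanced_hypercube n) (string_of_set n ` X)) = boundary_size n X"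
proof -
  let ?P = "SIGMA g:generators n. leaving g X"
  let ?f = "\<lambda>(g, x). {string_of_set n x, string_of_set n (flip g x)}"
  have P: "x \<in> X \<and> flip g x \<notin> X \<and> x \<subseteq> {..<n} \<and> flip g x \<subseteq> {..<n}" if "(g, x) \<in> ?P" for g x
    using that X flip_Pow[of x "{..<n}" g] generators_subset[of g n] unfolding leaving_def by auto
  have "edge_boundary (enhanced_hypercube n) (string_of_set n ` X) = ?f ` ?P"
  proof (intro set_eqI iffI)
    fix e assume "e \<in> edge_boundary (enhanced_hypercube n) (string_of_set n ` X)"
    then obtain x y where e: "e \<in> edges (enhanced_hypercube n)" "e = {string_of_set n x, string_of_set n y}"
      "x \<in> X" "y \<subseteq> {..<n}" "string_of_set n y \<notin> string_of_set n ` X"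
      unfolding edge_boundary_def vertices_enhanced_hypercube by auto
    have x: "x \<subseteq> {..<n}" using e(3) X by auto
    have y: "y \<notin> X" using e(5) by auto
    obtain z g where z: "e = {string_of_set n z, string_of_set n (flip g z)}" "z \<subseteq> {..<n}" "g \<in> generators n"
      using e(1) unfolding edges_enhanced_hypercube[OF n] by auto
    have fz: "flip g z \<subseteq> {..<n}" using flip_Pow[OF z(2) generators_subset[OF z(3)]] .
    have "x = z \<and> y = flip g z \<or> x = flip g z \<and> y = z"
      using e(2) z(1) inj_on_string_of_set[of n] x e(4) z(2) fz
        unfolding doubleton_eq_iff inj_on_def by blast
    then have "y = flip g x" by auto
    then have "(g, x) \<in> ?P" "e = ?f (g, x)" using z(3) e y unfolding leaving_def by auto
    then show "e \<in> ?f ` ?P" by blast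
  next
    fix e assume "e \<in> ?f ` ?P"
    then obtain g x where gx: "(g, x) \<in> ?P" "e = {string_of_set n x, string_of_set n (flip g x)}" by auto
    note p = P[OF gx(1)]
    have "e \<in> edges (enhanced_hypercube n)"
      unfolding edges_enhanced_hypercube[OF n] using gx p by auto
    moreover have "string_of_set n (flip g x) \<notin> string_of_set n ` X"
      using p string_of_set_mem_iff[OF X] by blast
    ultimately show "e \<in> edge_boundary (enhanced_hypercube n) (string_of_set n ` X)"
      unfolding edge_boundary_def vertices_enhanced_hypercube using gx(2) p by blast
  qed
  moreover have "inj_on ?f ?P"
  proof (rule inj_onI, clarify)
    fix g x h y assume a: "g \<in> generators n" "x \<in> leaving g X" "h \<in> generators n" "y \<in> leaving h X"
      and eq: "{string_of_set n x, string_of_set n (flip g x)} = {string_of_set n y, string_of_set n (flip h y)}"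
    have p: "x \<in> X \<and> flip g x \<notin> X \<and> x \<subseteq> {..<n} \<and> flip g x \<subseteq> {..<n}" using P[of g x] a by auto
    have q: "y \<in> X \<and> flip h y \<notin> X \<and> y \<subseteq> {..<n} \<and> flip h y \<subseteq> {..<n}" using P[of h y] a by auto
    have "x = y \<and> flip g x = flip h y \<or> x = flip h y \<and> flip g x = y"
      using eq p q inj_on_string_of_set[of n] unfolding doubleton_eq_iff inj_on_def by blast
    then have xy: "x = y" "flip g x = flip h x" using p q by auto
    then have "g = h" using flip_eq_iff[of x "flip g x"] flip_eq_iff by metis
    then show "g = h \<and> x = y" using xy by simp
  qed
  ultimately have "card (edge_boundary (enhanced_hypercube n) (string_of_set n ` X)) = card ?P"
    by (simp add: card_image)
  also have "\<dots> = boundary_size n X"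
    unfolding boundary_size_def
      using X finite_subset[OF X] by (intro card_SigmaI finite_generators) (auto simp: leaving_def)
  finally show ?thesis .
qed

text \<open>By induction on the number of missing elements every member is linked to the top member
  \<open>u\<close>; symmetry then links any two members.\<close>

lemma raisable_connected:
  assumes "raisable n Z" "Z \<subseteq> Pow {..<n}" "n \<ge> 1" "x \<in> Z" "y \<in> Z"
  defines "R \<equiv> {(a, b). a \<in> string_of_set n ` Z \<and> b \<in> string_of_set n ` Z \<and> {a, b} \<in> edges (enhanced_hypercube n)}"
  shows "(string_of_set n x, string_of_set n y) \<in> R\<^sup>*"
proof -
  obtain u where u: "u \<in> Z" "\<And>x. x \<in> Z \<Longrightarrow> x \<noteq> u \<Longrightarrow> \<exists>i<n. i \<notin> x \<and> insert i x \<in> Z"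
    using assms(1) unfolding raisable_def by auto
  have up: "(string_of_set n x, string_of_set n u) \<in> R\<^sup>*" if "x \<in> Z" for x
    using that
  proof (induction "card ({..<n} - x)" arbitrary: x rule: less_induct)
    case less
    show ?case
    proof (cases "x = u")
      case False
      then obtain i where i: "i < n" "i \<notin> x" "insert i x \<in> Z"
        using u(2) less.prems by blast
      have "{..<n} - insert i x \<subset> {..<n} - x" using i by auto
      then have "card ({..<n} - insert i x) < card ({..<n} - x)" by (intro psubset_card_mono) auto
      then have "(string_of_set n (insert i x), string_of_set n u) \<in> R\<^sup>*"
        using less.hyps i by blast
      moreover have "flip {i} x = insert i x" using i unfolding flip_def by auto
      then have "{string_of_set n x, string_of_set n (insert i x)} \<in> edges (enhanced_hypercube n)"
        unfolding edges_enhanced_hypercube[OF assms(3)] generators_def using less.prems assms(2) i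
        by (intro CollectI exI[of _ x] exI[of _ "{i}"]) auto
      then have "(string_of_set n x, string_of_set n (insert i x)) \<in> R"
        using less.prems i unfolding R_def by auto
      ultimately show ?thesis by (rule converse_rtrancl_into_rtrancl[rotated])
    qed simp
  qed
  have "sym (R\<^sup>*)" by (rule sym_rtrancl) (auto simp: R_def sym_def insert_commute)
  then have "(string_of_set n u, string_of_set n y) \<in> R\<^sup>*"
    using up[OF assms(5)] by (auto dest: symD)
  then show ?thesis using up[OF assms(4)] by (rule rtrancl_trans[rotated])
qed

section \<open>Bounds on the extra edge-connectivity\<close>

lemma extra_edge_connectivity_le:
  assumes X: "X \<subseteq> Pow {..<n}" and n: "n \<ge> 1"
    and r: "raisable n X" "raisable n (Pow {..<n} - X)"
    and h: "h \<le> card X" "h + card X \<le> 2 ^ n"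
  shows "extra_edge_connectivity h (enhanced_hypercube n) \<le> enat (boundary_size n X)"
proof -
  let ?G = "enhanced_hypercube n"
  let ?X = "string_of_set n ` X"
  have V: "vertices ?G - ?X = string_of_set n ` (Pow {..<n} - X)"
    unfolding vertices_enhanced_hypercube
      using inj_on_image_set_diff[OF inj_on_string_of_set _ X] by blast
  have inj: "inj_on (string_of_set n) X" "inj_on (string_of_set n) (Pow {..<n} - X)"
    using inj_on_subset[OF inj_on_string_of_set] X by auto
  have cX: "card (Pow {..<n} - X) + card X = 2 ^ n"
    using card_Diff_subset[OF finite_subset[OF X] X] card_mono[OF _ X] by (simp add: card_Pow)
  have "extra_edge_cut h ?G (edge_boundary ?G ?X)"
  proof (rule extra_edge_cut_edge_boundary)
    show "finite (vertices ?G)" unfolding vertices_enhanced_hypercube by simp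
    show "e \<subseteq> vertices ?G" if "e \<in> edges ?G" for e
      using that unfolding enhanced_hypercube_def by auto
    show "?X \<subseteq> vertices ?G" unfolding vertices_enhanced_hypercube using X by auto
    show "?X \<noteq> {}" "vertices ?G - ?X \<noteq> {}"
      unfolding V using r unfolding raisable_def by auto
    show "h \<le> card ?X" "h \<le> card (vertices ?G - ?X)"
      unfolding V using h cX by (simp_all add: card_image inj)
    fix Z x y assume Z: "Z = ?X \<or> Z = vertices ?G - ?X" and xy: "x \<in> Z" "y \<in> Z"
    obtain Y where Y: "Z = string_of_set n ` Y" "raisable n Y" "Y \<subseteq> Pow {..<n}"
      using Z r X unfolding V by blast
    then obtain a b where "x = string_of_set n a" "y = string_of_set n b" "a \<in> Y" "b \<in> Y"
      using xy by auto
    then show "(x, y) \<in> {(a, b). a \<in> Z \<and> b \<in> Z \<and> {a, b} \<in> edges ?G}\<^sup>*"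
      using raisable_connected[OF Y(2,3) n] unfolding Y(1) by simp
  qed
  then have "extra_edge_connectivity h ?G \<le> enat (card (edge_boundary ?G ?X))"
    unfolding extra_edge_connectivity_def by (intro INF_lower) simp
  then show ?thesis unfolding card_edge_boundary[OF X n] .
qed

text \<open>\<open>X\<close> encodes a component with at most half of the vertices. This serves both
  for the lower bound on cuts and for their nonexistence when \<open>h\<close> is large.\<close>

lemma extra_edge_cut_component:
  assumes "extra_edge_cut h (enhanced_hypercube n) F"
  obtains X where "X \<subseteq> Pow {..<n}" "h \<le> card X" "2 * card X \<le> 2 ^ n"
    "edge_boundary (enhanced_hypercube n) (string_of_set n ` X) \<subseteq> F"
proof -
  let ?G = "enhanced_hypercube n"
  let ?H = "delete_edges ?G F"
  have VH: "vertices ?H = string_of_set n ` Pow {..<n}"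
    unfolding delete_edges_def using vertices_enhanced_hypercube by simp
  obtain C where C: "C \<in> components ?H" "2 * card C \<le> card (vertices ?H)"
    using exists_small_component[of ?H] assms unfolding extra_edge_cut_def VH by auto
  have "C \<subseteq> string_of_set n ` Pow {..<n}" using component_subset[OF C(1)] unfolding VH .
  then obtain X where X: "X \<subseteq> Pow {..<n}" "C = string_of_set n ` X"
    by (meson subset_imageE)
  have "card C = card X"
    unfolding X(2) by (rule card_image[OF inj_on_subset[OF inj_on_string_of_set X(1)]])
  moreover have "card (vertices ?H) = 2 ^ n"
    unfolding VH by (simp add: card_image[OF inj_on_string_of_set] card_Pow)
  moreover have "h \<le> card C" using assms C(1) unfolding extra_edge_cut_def by auto
  ultimately show ?thesis using that X C edge_boundary_component[OF C(1)] by auto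
qed

lemma le_extra_edge_connectivity:
  assumes "11 * 2 ^ k \<le> 12 * h"
  shows "enat (4 * 2 ^ k) \<le> extra_edge_connectivity h (enhanced_hypercube (k + 3))"
  unfolding extra_edge_connectivity_def
proof (rule INF_greatest)
  let ?G = "enhanced_hypercube (k + 3)"
  fix F assume "F \<in> {F. extra_edge_cut h ?G F}"
  then have F: "extra_edge_cut h ?G F" by simp
  obtain X where X: "X \<subseteq> Pow {..<k + 3}" "h \<le> card X" "2 * card X \<le> 2 ^ (k + 3)"
    "edge_boundary ?G (string_of_set (k + 3) ` X) \<subseteq> F"
    using extra_edge_cut_component[OF F] .
  have "finite (edges ?G)"
  proof (rule finite_subset)
    show "edges ?G \<subseteq> Pow (vertices ?G)" unfolding enhanced_hypercube_def by auto
    show "finite (Pow (vertices ?G))" unfolding vertices_enhanced_hypercube by simp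
  qed
  then have "finite F" using F finite_subset unfolding extra_edge_cut_def by blast
  then have "boundary_size (k + 3) X \<le> card F"
    using card_mono[OF _ X(4)] card_edge_boundary[OF X(1)] by simp
  moreover have "4 * 2 ^ k \<le> boundary_size (k + 3) X"
    using boundary_size_ge[OF X(1)] assms X(2,3) by (simp add: power_add)
  ultimately show "enat (4 * 2 ^ k) \<le> enat (card F)" by simp
qed

theorem mainTheorem2:
  fixes n h0 :: nat
  assumes "n \<ge> 9"
    and "h0 = nat \<lceil>(11 * 2 ^ (n - 1) / 48 :: real)\<rceil>"
  shows "(extra_edge_connectivity (h0 - 1) (enhanced_hypercube n) < enat (2 ^ (n - 1)) \<and>
          extra_edge_connectivity h0 (enhanced_hypercube n) = enat (2 ^ (n - 1))) \<and>
         (\<forall>h > 2 ^ (n - 1). \<not> (\<exists>F. extra_edge_cut h (enhanced_hypercube n) F))"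
proof (intro conjI allI impI notI)
  \<comment> \<open>Subcubes of codimension 3 have \<open>2 ^ k\<close> vertices, so
    \<open>2 ^ (n - 1)\<close> is \<open>4 * 2 ^ k\<close> and the threshold becomes
    \<open>11 * 2 ^ k / 12\<close>.\<close>
  obtain k where n: "n = k + 3" and k: "k \<ge> 6"
    using assms(1) by (intro that[of "n - 3"]) auto
  have p: "2 ^ (n - 1) = 4 * (2::nat) ^ k" unfolding n by (simp add: power_add)
  have h0: "h0 = nat \<lceil>(11 * 2 ^ k / 12 :: real)\<rceil>"
    unfolding assms(2) n by (simp add: power_add)
  have lo: "11 * 2 ^ k \<le> 12 * h0"
  proof -
    have "11 * 2 ^ k / 12 \<le> real h0" unfolding h0 by (rule real_nat_ceiling_ge)
    then have "real (11 * 2 ^ k) \<le> real (12 * h0)" by simp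
    then show ?thesis by (simp only: of_nat_le_iff)
  qed
  \<comment> \<open>This makes \<open>h0 - 1\<close> at most
    \<open>2 ^ k - (2 ^ k div 12 + 1)\<close>, the size of the set given by
    \<open>exists_small_boundary\<close>.\<close>
  have hi: "h0 + 2 ^ k div 12 \<le> 2 ^ k"
  proof -
    have "12 * (2 ^ k div 12) \<le> (2::nat) ^ k" by simp
    then have "real (12 * (2 ^ k div 12)) \<le> real (2 ^ k)" by (simp only: of_nat_le_iff)
    then have "11 * 2 ^ k / 12 \<le> real (2 ^ k - 2 ^ k div 12)" by (simp add: of_nat_diff)
    then have "h0 \<le> 2 ^ k - 2 ^ k div 12" unfolding h0 by (simp add: nat_le_iff ceiling_le_iff)
    moreover have "2 ^ k div 12 \<le> (2::nat) ^ k" by simp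
    ultimately show ?thesis by linarith
  qed
  show "extra_edge_connectivity (h0 - 1) (enhanced_hypercube n) < enat (2 ^ (n - 1))"
  proof -
    obtain X where X: "X \<subseteq> Pow {..<k}" "card X + (2 ^ k div 12 + 1) = 2 ^ k"
      "boundary_size (k + 3) X < 4 * 2 ^ k" "raisable (k + 3) X" "raisable (k + 3) (Pow {..<k + 3} - X)"
      using exists_small_boundary[of k] k by auto
    have "X \<subseteq> Pow {..<k + 3}" using X(1) by fastforce
    then have "extra_edge_connectivity (h0 - 1) (enhanced_hypercube n) \<le> enat (boundary_size (k + 3) X)"
      unfolding n
        by (rule extra_edge_connectivity_le) (use X hi in \<open>auto simp: power_add\<close>)
    also have "\<dots> < enat (2 ^ (n - 1))" using X(3) p by simp
    finally show ?thesis .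
  qed
  show "extra_edge_connectivity h0 (enhanced_hypercube n) = enat (2 ^ (n - 1))"
  proof (rule antisym)
    \<comment> \<open>Deleting the matching separates the two copies of the folded
      hypercube.\<close>
    have "extra_edge_connectivity h0 (enhanced_hypercube n) \<le> enat (boundary_size n (Pow {..<k + 2}))"
    proof (rule extra_edge_connectivity_le)
      show "Pow {..<k + 2} \<subseteq> Pow {..<n}" unfolding n by fastforce
      show "raisable n (Pow {..<k + 2})" unfolding n by (rule raisable_Pow) simp
      show "raisable n (Pow {..<n} - Pow {..<k + 2})"
        using raisable_compl[of "{}" "k + 2" n] n by simp
    qed (use hi in \<open>simp_all add: n card_Pow power_add\<close>)
    also have "boundary_size n (Pow {..<k + 2}) = 2 ^ (n - 1)"
      using boundary_size_half[of "k + 2"] unfolding n by (simp add: numeral_3_eq_3)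
    finally show "extra_edge_connectivity h0 (enhanced_hypercube n) \<le> enat (2 ^ (n - 1))" .
    show "enat (2 ^ (n - 1)) \<le> extra_edge_connectivity h0 (enhanced_hypercube n)"
      using le_extra_edge_connectivity[OF lo] p unfolding n by simp
  qed
  fix h :: nat assume h: "h > 2 ^ (n - 1)" "\<exists>F. extra_edge_cut h (enhanced_hypercube n) F"
  then obtain F where "extra_edge_cut h (enhanced_hypercube n) F" by auto
  then obtain X where "X \<subseteq> Pow {..<n}" "h \<le> card X" "2 * card X \<le> 2 ^ n"
    "edge_boundary (enhanced_hypercube n) (string_of_set n ` X) \<subseteq> F"
    by (rule extra_edge_cut_component)
  moreover have "(2::nat) ^ n = 2 * 2 ^ (n - 1)" using assms(1) by (simp flip: power_Suc)
  ultimately show False using h(1) by linarith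
qed

end
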